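(* Let $\mathcal{P}=(P,d\mu,d\sigma)$ be a $2$-dimensional system. Then every $q\in\mathcal{E}^1(P)$ that minimizes the functional $q\mapsto\frac{\int_{\partial P}e^q\,d\sigma}{\int_Pe^q\,d\mu}$ over $\mathcal{E}^1(P)$ (equivalently, maximizes $\check{\mu}_{\mathrm{NA}}(q)=-2\pi\frac{\int_{\partial P}e^q\,d\sigma}{\int_Pe^q\,d\mu}$) is bounded and continuous on $P$. Equivalently, every minimizer of $U_{\mathcal{P}}$ on $\mathcal{M}^1(P)$ is bounded and continuous.
   Context: An $n$-dimensional system is a triple $\mathcal{P}=(P,d\mu,d\sigma)$ where $P$ is a simple polytope in an $n$-dimensional real affine space $V$ (a compact subset with non-empty interior that is a finite intersection of closed half spaces, such that every vertex is the intersection of exactly $n$ facets), $d\mu$ is the restriction to $P$ of a translation-invariant measure on $V$ that is positive and finite on bounded non-empty open sets (i.e. a positive multiple of Lebesgue measure), and $d\sigma$ is a measure on the boundary $\partial P$ whose restriction to each facet is a positive multiple of the Lebesgue measure of the affine hyperplane spanned by that facet. $\mathcal{E}^1(P)$ is the set of lower semicontinuous convex functions $q:P\to(-\infty,\infty]$ with $\int_Pe^q\,d\mu<\infty$. $\mathcal{M}^1(P)$ is the set of lower semicontinuous log-convex functions $u:P\to(0,\infty]$ with $\int_Pu\,d\mu=\int_Pd\mu$, and $U_{\mathcal{P}}(u):=\frac{1}{\int_Pd\mu}\int_{\partial P}u\,d\sigma$. *)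

theory Defs
  imports "HOL-Analysis.Analysis"
begin

definition simple_polytope :: "'a::euclidean_space set \<Rightarrow> bool" where
  "simple_polytope P \<longleftrightarrow> polyhedron P \<and> compact P \<and> interior P \<noteq> {} \<and>
     (\<forall>v. v extreme_point_of P \<longrightarrow> card {F. F facet_of P \<and> v \<in> F} = DIM('a))"

text \<open>A 2-dimensional system (P, d mu, d sigma).  mu is the restriction to P of a
  positive multiple of Lebesgue measure; sigma is a Borel measure carried by the
  boundary of P whose restriction to each facet F (a segment, since the dimension
  is 2) is a positive multiple of the Lebesgue (arc-length) measure of the line
  spanned by F, written via a unit-speed parametrisation of that line.\<close>
definition system2 :: "'a::euclidean_space set \<Rightarrow> 'a measure \<Rightarrow> 'a measure \<Rightarrow> bool" where
  "system2 P \<mu> \<sigma> \<longleftrightarrow> DIM('a) = 2 \<and> simple_polytope P \<and>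
     (\<exists>c>0. \<mu> = density lborel (\<lambda>x. ennreal c * indicator P x)) \<and>
     sets \<sigma> = sets borel \<and> emeasure \<sigma> (- frontier P) = 0 \<and>
     (\<forall>F. F facet_of P \<longrightarrow>
        (\<exists>c>0. \<exists>a d. norm d = 1 \<and> F \<subseteq> range (\<lambda>t::real. a + t *\<^sub>R d) \<and>
           (\<forall>A\<in>sets borel. emeasure \<sigma> (A \<inter> F) =
               ennreal c * emeasure lborel ((\<lambda>t::real. a + t *\<^sub>R d) -` (A \<inter> F)))))"

definition eexp :: "ereal \<Rightarrow> ennreal" where
  "eexp z = (if z = \<infinity> then \<infinity> else if z = -\<infinity> then 0 else ennreal (exp (real_of_ereal z)))"

definition eln :: "ennreal \<Rightarrow> ereal" where
  "eln u = (if u = \<infinity> then \<infinity> else if u = 0 then -\<infinity> else ereal (ln (enn2real u)))"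

definition lsc_on :: "'a::topological_space set \<Rightarrow> ('a \<Rightarrow> 'b::complete_linorder) \<Rightarrow> bool" where
  "lsc_on P f \<longleftrightarrow> (\<forall>x\<in>P. f x \<le> Liminf (at x within P) f)"

definition econvex_on :: "'a::real_vector set \<Rightarrow> ('a \<Rightarrow> ereal) \<Rightarrow> bool" where
  "econvex_on P q \<longleftrightarrow> (\<forall>x\<in>P. \<forall>y\<in>P. \<forall>t::real. 0 \<le> t \<and> t \<le> 1 \<longrightarrow>
      q ((1 - t) *\<^sub>R x + t *\<^sub>R y) \<le> ereal (1 - t) * q x + ereal t * q y)"

definition E1 :: "'a::euclidean_space set \<Rightarrow> 'a measure \<Rightarrow> ('a \<Rightarrow> ereal) set" where
  "E1 P \<mu> = {q. (\<forall>x\<in>P. q x \<noteq> -\<infinity>) \<and> lsc_on P q \<and> econvex_on P q \<and>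
                 (\<integral>\<^sup>+x\<in>P. eexp (q x) \<partial>\<mu>) < \<infinity>}"

definition NA_ratio :: "'a::euclidean_space set \<Rightarrow> 'a measure \<Rightarrow> 'a measure \<Rightarrow> ('a \<Rightarrow> ereal) \<Rightarrow> ennreal" where
  "NA_ratio P \<mu> \<sigma> q = (\<integral>\<^sup>+x. eexp (q x) \<partial>\<sigma>) / (\<integral>\<^sup>+x\<in>P. eexp (q x) \<partial>\<mu>)"

definition M1 :: "'a::euclidean_space set \<Rightarrow> 'a measure \<Rightarrow> ('a \<Rightarrow> ennreal) set" where
  "M1 P \<mu> = {u. (\<forall>x\<in>P. u x > 0) \<and> lsc_on P u \<and> econvex_on P (\<lambda>x. eln (u x)) \<and>
                 (\<integral>\<^sup>+x\<in>P. u x \<partial>\<mu>) = emeasure \<mu> P}"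

definition U_fun :: "'a::euclidean_space set \<Rightarrow> 'a measure \<Rightarrow> 'a measure \<Rightarrow> ('a \<Rightarrow> ennreal) \<Rightarrow> ennreal" where
  "U_fun P \<mu> \<sigma> u = (\<integral>\<^sup>+x. u x \<partial>\<sigma>) / emeasure \<mu> P"

end

theory Submission
  imports Defs
begin

text \<open>For a direction \<open>e \<noteq> 0\<close> and \<open>c > 0\<close>, regularise a minimiser \<open>q\<close> to
  \<open>r z = inf {q (z + t e) + c t | t \<ge> 0}\<close>, which is again convex and lower semicontinuous,
  lies below \<open>q\<close>, and has slope at least \<open>- c\<close> in direction \<open>e\<close>.  Let \<open>w = exp q - exp r\<close>.
  On a line in direction \<open>e\<close> that enters \<open>P\<close> at a boundary point \<open>b\<close>, convexity of \<open>q\<close> gives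
  \<open>w (b + \<tau> e) \<le> exp (- c \<tau>) w b\<close>.  Integrating over all such lines, the integral of \<open>w\<close> over
  \<open>P\<close> is at most \<open>C |e| / c\<close> times its integral over the boundary.  Passing from \<open>q\<close> to \<open>r\<close>
  removes these two integrals from the denominator and the numerator of the ratio, so for
  \<open>c / |e|\<close> large, independently of \<open>e\<close>, minimality forces \<open>w = 0\<close> almost everywhere.
  Thus the slopes of \<open>q\<close> in unit directions are uniformly bounded below, so \<open>q\<close> is Lipschitz on \<open>P\<close>.  Minimisers of
  \<open>U\<close> are exponentials of minimisers of the ratio, up to normalisation.\<close>

subsection \<open>Lower semicontinuity, convexity and epigraphs\<close>

text \<open>The punctured neighbourhoods behind \<open>Liminf (at x within P)\<close> may be
  replaced by full ones, since \<open>y < f x\<close> already settles the point \<open>x\<close>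
  itself.\<close>

lemma lsc_on_iff_nhds:
  "lsc_on P f \<longleftrightarrow> (\<forall>x\<in>P. \<forall>y<f x. \<exists>S. open S \<and> x \<in> S \<and> (\<forall>z\<in>S \<inter> P. y < f z))"
proof -
  have "(\<exists>S. open S \<and> x \<in> S \<and> (\<forall>z\<in>S. z \<noteq> x \<longrightarrow> z \<in> P \<longrightarrow> y < f z)) \<longleftrightarrow>
      (\<exists>S. open S \<and> x \<in> S \<and> (\<forall>z\<in>S \<inter> P. y < f z))" if "y < f x" for x y
    using that by (intro ex_cong1 conj_cong refl) auto
  then show ?thesis
    unfolding lsc_on_def le_Liminf_iff eventually_at_topological by (intro ball_cong refl) auto
qed

lemma closed_sublevel:
  fixes P :: "'a::topological_space set"
  assumes "closed P" "lsc_on P f"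
  shows "closed {x\<in>P. f x \<le> y}"
  unfolding closed_def
proof (subst open_subopen, intro ballI)
  fix x assume "x \<in> - {x\<in>P. f x \<le> y}"
  then consider "x \<notin> P" | "x \<in> P" "y < f x" by fastforce
  then show "\<exists>T. open T \<and> x \<in> T \<and> T \<subseteq> - {x\<in>P. f x \<le> y}"
  proof cases
    case 1
    then show ?thesis using assms(1) by (intro exI[of _ "- P"]) auto
  next
    case 2
    then obtain S where "open S" "x \<in> S" "\<forall>z\<in>S \<inter> P. y < f z"
      using assms(2) unfolding lsc_on_iff_nhds by blast
    then show ?thesis by (intro exI[of _ S]) (auto dest: leD)
  qed
qed

text \<open>Extending by \<infinity> off the closed set \<open>P\<close> leaves every sublevel set
  below the level \<infinity> closed.\<close>

lemma borel_measurable_lsc_on: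
  fixes f :: "'a::topological_space \<Rightarrow> ereal"
  assumes "closed P" "lsc_on P f"
  shows "(\<lambda>x. if x \<in> P then f x else \<infinity>) \<in> borel_measurable borel"
proof (rule borel_measurableI_le)
  fix y :: ereal
  have "{x \<in> space borel. (if x \<in> P then f x else \<infinity>) \<le> y} =
      (if y = \<infinity> then UNIV else {x\<in>P. f x \<le> y})"
    by auto
  then show "{x \<in> space borel. (if x \<in> P then f x else \<infinity>) \<le> y} \<in> sets borel"
    using closed_sublevel[OF assms, of y] by auto
qed

text \<open>The sublevel sets at the levels -n are compact and nested. A point common to all of them
  would have the value -\<infinity>, so one of them is empty.\<close>

lemma lsc_on_compact_bounded_below:
  fixes f :: "'a::euclidean_space \<Rightarrow> ereal"
  assumes "compact P" "lsc_on P f" "\<And>x. x \<in> P \<Longrightarrow> f x \<noteq> -\<infinity>"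
  obtains m where "\<And>x. x \<in> P \<Longrightarrow> ereal m \<le> f x"
proof -
  define K where "K n = {x\<in>P. f x \<le> ereal (- real n)}" for n
  have K: "compact (K n)" for n
  proof -
    have "K n = P \<inter> {x\<in>P. f x \<le> ereal (- real n)}" unfolding K_def by blast
    then show ?thesis
      using compact_Int_closed[OF assms(1) closed_sublevel[OF compact_imp_closed[OF assms(1)] assms(2)]]
      by simp
  qed
  have "\<exists>n. K n = {}"
  proof (rule ccontr)
    assume *: "\<nexists>n. K n = {}"
    have "\<Inter> (range K) \<noteq> {}"
    proof (rule compact_nest[OF K])
      show "K n \<subseteq> K m" if "m \<le> n" for m n
      proof -
        have "ereal (- real n) \<le> ereal (- real m)" using that by simp
        then show ?thesis unfolding K_def by (auto intro: order_trans)
      qed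
    qed (use * in auto)
    then obtain x where x: "\<And>n. x \<in> K n" by auto
    then have "x \<in> P" "f x \<le> ereal (- real 0)" unfolding K_def by blast+
    then obtain r where r: "f x = ereal r" using assms(3) by (cases "f x") auto
    obtain n where "- r < real n" using reals_Archimedean2 by blast
    then show False using x[of n] r unfolding K_def by simp
  qed
  then obtain n where "K n = {}" by blast
  then have "ereal (- real n) \<le> f x" if "x \<in> P" for x
    using that unfolding K_def by (metis (mono_tags, lifting) empty_iff linear mem_Collect_eq)
  then show thesis by (rule that)
qed

text \<open>The epigraph, with real heights so that it lies in the vector space
  \<open>'a \<times> real\<close>. Lower semicontinuity and convexity become closedness and
  convexity of one set, and both properties survive the Minkowski sums used below.\<close>

definition epi_on :: "'a set \<Rightarrow> ('a \<Rightarrow> ereal) \<Rightarrow> ('a \<times> real) set" where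
  "epi_on P q = {(x, r). x \<in> P \<and> q x \<le> ereal r}"

text \<open>Over a point \<open>x\<close> of \<open>P\<close>, a level \<open>s\<close> strictly
  between the height \<open>r\<close> and \<open>q x\<close> gives a product neighbourhood with
  second factor \<open>{..<s}\<close> that misses the epigraph.\<close>

lemma closed_epi_on:
  fixes P :: "'a::first_countable_topology set"
  assumes "closed P" "lsc_on P q"
  shows "closed (epi_on P q)"
  unfolding closed_def
proof (subst open_subopen, intro ballI)
  fix p assume "p \<in> - epi_on P q"
  then obtain x r where p: "p = (x, r)" and "x \<notin> P \<or> x \<in> P \<and> ereal r < q x"
    by (cases p) (auto simp: epi_on_def not_le)
  then show "\<exists>T. open T \<and> p \<in> T \<and> T \<subseteq> - epi_on P q"
  proof (elim disjE conjE)
    assume "x \<notin> P"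
    then show ?thesis using assms(1) p
      by (intro exI[of _ "(- P) \<times> UNIV"]) (auto simp: epi_on_def intro: open_Times)
  next
    assume x: "x \<in> P" "ereal r < q x"
    then obtain s where s: "ereal r < ereal s" "ereal s < q x" using ereal_dense2 by blast
    obtain S where "open S" "x \<in> S" "\<forall>z\<in>S \<inter> P. ereal s < q z"
      using assms(2) x s unfolding lsc_on_iff_nhds by blast
    then show ?thesis using p s
      by (intro exI[of _ "S \<times> {..<s}"])
        (auto simp: epi_on_def intro!: open_Times,
         metis IntI ereal_less_eq(3) leD less_le_trans less_imp_le order_le_less_trans)
  qed
qed

lemma lsc_on_if_closed_epi_on:
  assumes "closed (epi_on P q)"
  shows "lsc_on P q"
  unfolding lsc_on_iff_nhds
proof (intro ballI allI impI)
  fix x y assume x: "x \<in> P" "y < q x"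
  then obtain s where s: "y < ereal s" "ereal s < q x" using ereal_dense2 by blast
  have "(x, s) \<in> - epi_on P q" using x s by (auto simp: epi_on_def)
  then obtain A B where AB: "open A" "open B" "x \<in> A" "s \<in> B" "A \<times> B \<subseteq> - epi_on P q"
    using assms unfolding closed_def open_prod_def by (metis SigmaD1 SigmaD2)
  have "y < q z" if "z \<in> A" "z \<in> P" for z
    using AB(4,5) that s by (auto simp: epi_on_def subset_iff not_le intro: less_trans)
  then show "\<exists>S. open S \<and> x \<in> S \<and> (\<forall>z\<in>S \<inter> P. y < q z)" using AB by blast
qed

lemma convex_epi_on:
  assumes "convex P" "econvex_on P q"
  shows "convex (epi_on P q)"
  unfolding convex_alt
proof (intro ballI allI impI)
  fix a b :: "'a \<times> real" and t :: real
  assume ab: "a \<in> epi_on P q" "b \<in> epi_on P q" and t: "0 \<le> t \<and> t \<le> 1"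
  obtain x r y s where [simp]: "a = (x, r)" "b = (y, s)" by fastforce
  have "q ((1 - t) *\<^sub>R x + t *\<^sub>R y) \<le> ereal (1 - t) * q x + ereal t * q y"
    using assms(2) ab t unfolding econvex_on_def by (auto simp: epi_on_def)
  also have "\<dots> \<le> ereal (1 - t) * ereal r + ereal t * ereal s"
    using ab t by (intro add_mono ereal_mult_left_mono) (auto simp: epi_on_def)
  finally show "(1 - t) *\<^sub>R a + t *\<^sub>R b \<in> epi_on P q"
    using assms(1) ab t by (auto simp: epi_on_def convex_alt)
qed

lemma econvex_on_if_convex_epi_on:
  assumes "convex (epi_on P q)" "\<And>x. x \<in> P \<Longrightarrow> q x \<noteq> -\<infinity>"
  shows "econvex_on P q"
  unfolding econvex_on_def
proof (intro ballI allI impI)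
  fix x y and t :: real
  assume xy: "x \<in> P" "y \<in> P" and t: "0 \<le> t \<and> t \<le> 1"
  \<comment> \<open>The end points are treated apart because \<open>0 * \<infinity> = 0\<close> in
    \<open>ereal\<close>: an infinite value makes the right-hand side infinite only when its weight
    is positive.\<close>
  consider "t = 0" | "t = 1" | "0 < t" "t < 1" using t by linarith
  then show "q ((1 - t) *\<^sub>R x + t *\<^sub>R y) \<le> ereal (1 - t) * q x + ereal t * q y"
  proof cases
    case 3
    show ?thesis
    proof (cases "q x = \<infinity> \<or> q y = \<infinity>")
      case True
      then have "ereal (1 - t) * q x + ereal t * q y = \<infinity>"
        using 3 assms(2)[OF xy(1)] assms(2)[OF xy(2)] 
        by (cases "q x"; cases "q y") (auto simp: mult_pos_pos)
      then show ?thesis by (simp only: ereal_less_eq)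
    next
      case False
      then obtain r s where rs: "q x = ereal r" "q y = ereal s"
        using assms(2) xy by (metis ereal_cases)
      then have "(x, r) \<in> epi_on P q" "(y, s) \<in> epi_on P q" using xy by (auto simp: epi_on_def)
      then have "(1 - t) *\<^sub>R (x, r) + t *\<^sub>R (y, s) \<in> epi_on P q"
        using assms(1) t unfolding convex_alt by blast
      then show ?thesis using rs by (auto simp: epi_on_def)
    qed
  qed (auto simp: zero_ereal_def[symmetric])
qed

section \<open>Regularisation of the slope in one direction\<close>

text \<open>This is the infimal convolution of \<open>q\<close>, extended by \<infinity> off
  \<open>P\<close>, with the function that is \<open>c * t\<close> at \<open>- t *\<^sub>R e\<close>
  for \<open>t \<ge> 0\<close> and \<infinity> elsewhere.\<close>

definition slope_reg :: "'a::real_normed_vector set \<Rightarrow> 'a \<Rightarrow> real \<Rightarrow> ('a \<Rightarrow> ereal) \<Rightarrow> 'a \<Rightarrow> ereal" where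
  "slope_reg P e c q z = (INF t\<in>{t. 0 \<le> t \<and> z + t *\<^sub>R e \<in> P}. q (z + t *\<^sub>R e) + ereal (c * t))"

lemma slope_reg_le_shift:
  "0 \<le> t \<Longrightarrow> z + t *\<^sub>R e \<in> P \<Longrightarrow> slope_reg P e c q z \<le> q (z + t *\<^sub>R e) + ereal (c * t)"
  unfolding slope_reg_def by (intro INF_lower) simp

lemma slope_reg_le: "z \<in> P \<Longrightarrow> slope_reg P e c q z \<le> q z"
  using slope_reg_le_shift[of 0 z e P c q] by (simp add: zero_ereal_def[symmetric])

lemma slope_reg_ge:
  assumes "\<And>x. x \<in> P \<Longrightarrow> ereal m \<le> q x" "0 \<le> c"
  shows "ereal m \<le> slope_reg P e c q z"
  unfolding slope_reg_def
proof (intro INF_greatest)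
  fix t assume t: "t \<in> {t. 0 \<le> t \<and> z + t *\<^sub>R e \<in> P}"
  then have "ereal m + 0 \<le> q (z + t *\<^sub>R e) + ereal (c * t)"
    using assms by (intro add_mono) auto
  then show "ereal m \<le> q (z + t *\<^sub>R e) + ereal (c * t)" by simp
qed

text \<open>Infimal convolution adds epigraphs. Compactness of \<open>P\<close> bounds the
  admissible \<open>t\<close>, so the ray spanned by \<open>(- e, c)\<close> can be cut to a
  segment, and the sum of a closed and a compact set is closed. This closedness also gives the
  equality of the two sets, because it forces the infimum to be attained.\<close>

lemma epi_on_slope_reg:
  fixes P :: "'a::real_normed_vector set"
  assumes "compact P" "lsc_on P q" "e \<noteq> 0"
  obtains R where "epi_on P (slope_reg P e c q) =
    (P \<times> UNIV) \<inter> (\<Union>x\<in>epi_on P q. \<Union>y\<in>closed_segment 0 (R *\<^sub>R (- e, c)). {x + y})"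
    and "closed (epi_on P (slope_reg P e c q))"
proof -
  obtain B where B: "\<And>x. x \<in> P \<Longrightarrow> norm x \<le> B"
    using compact_imp_bounded[OF assms(1)] bounded_iff by blast
  \<comment> \<open>Two points of \<open>P\<close> are at most \<open>2 * B\<close> apart, which
    bounds \<open>t\<close>; the maximum keeps \<open>R\<close> nonnegative even if \<open>P\<close>
    is empty.\<close>
  define R where "R = max 0 (2 * B / norm e)"
  then have "0 \<le> R" by simp
  have R: "t \<le> R" if "z \<in> P" "0 \<le> t" "z + t *\<^sub>R e \<in> P" for z t
  proof -
    have "t * norm e = norm ((z + t *\<^sub>R e) - z)" using that by simp
    also have "\<dots> \<le> B + B" using B[OF that(1)] B[OF that(3)] norm_triangle_ineq4[of "z + t *\<^sub>R e" z] by linarith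
    finally show ?thesis using assms(3) unfolding R_def by (auto simp: field_simps le_max_iff_disj)
  qed
  let ?E = "(P \<times> UNIV) \<inter> (\<Union>x\<in>epi_on P q. \<Union>y\<in>closed_segment 0 (R *\<^sub>R (- e, c)). {x + y})"
  have E: "(z, r) \<in> ?E" if "z \<in> P" "0 \<le> t" "z + t *\<^sub>R e \<in> P" "q (z + t *\<^sub>R e) \<le> ereal (r - c * t)" for z r t
  proof -
    have "\<exists>s\<in>{0..1}. t = s * R"
      using R[OF that(1-3)] that(2) by (cases "R = 0") (auto intro!: bexI[of _ "t / R"] simp: field_simps)
    then obtain s where "0 \<le> s" "s \<le> 1" "t = s * R" by auto
    then have "t *\<^sub>R (- e, c) \<in> closed_segment 0 (R *\<^sub>R (- e, c))"
      by (auto simp: closed_segment_def intro!: exI[of _ s])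
    moreover have "(z + t *\<^sub>R e, r - c * t) \<in> epi_on P q" using that by (auto simp: epi_on_def)
    moreover have "(z, r) = (z + t *\<^sub>R e, r - c * t) + t *\<^sub>R (- e, c)" by simp
    ultimately show ?thesis using that(1) by blast
  qed
  have cl: "closed ?E"
  proof (intro closed_Int closed_Times closed_compact_sums)
    show "closed P" "closed (epi_on P q)"
      using assms by (auto intro: compact_imp_closed closed_epi_on)
  qed auto
  have "epi_on P (slope_reg P e c q) = ?E"
  proof (intro equalityI subrelI)
    fix z r assume zr: "(z, r) \<in> epi_on P (slope_reg P e c q)"
    \<comment> \<open>The infimum is only approximated: raising the height by
      \<open>1 / real (Suc n)\<close> gives a strict inequality and hence an admissible
      \<open>t\<close>. Closedness of the sum then allows the limit.\<close>
    have "(z, r + 1 / real (Suc n)) \<in> ?E" for n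
    proof -
      have "slope_reg P e c q z < ereal (r + 1 / real (Suc n))"
        using zr by (auto simp: epi_on_def intro: le_less_trans)
      then obtain t where t: "0 \<le> t" "z + t *\<^sub>R e \<in> P" "q (z + t *\<^sub>R e) + ereal (c * t) < ereal (r + 1 / real (Suc n))"
        unfolding slope_reg_def INF_less_iff by auto
      show ?thesis
      proof (rule E[OF _ t(1,2)])
        show "z \<in> P" using zr by (simp add: epi_on_def)
        show "q (z + t *\<^sub>R e) \<le> ereal (r + 1 / real (Suc n) - c * t)"
          using t(3) by (cases "q (z + t *\<^sub>R e)") auto
      qed
    qed
    moreover have "(\<lambda>n. (z, r + 1 / real (Suc n))) \<longlonglongrightarrow> (z, r + 0)"
      by (intro tendsto_intros LIMSEQ_inverse_real_of_nat[unfolded inverse_eq_divide])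
    ultimately have "(z, r + 0) \<in> ?E" by (rule closed_sequentially[OF cl])
    then show "(z, r) \<in> ?E" by (simp only: add_0_right)
  next
    fix z r assume "(z, r) \<in> ?E"
    then obtain p y where "z \<in> P" "p \<in> epi_on P q" "y \<in> closed_segment 0 (R *\<^sub>R (- e, c))" "(z, r) = p + y"
      by blast
    then obtain x s where *: "z \<in> P" "(x, s) \<in> epi_on P q" "y \<in> closed_segment 0 (R *\<^sub>R (- e, c))" "(z, r) = (x, s) + y"
      by (metis surj_pair)
    then obtain k where "0 \<le> k" "y = (k * R) *\<^sub>R (- e, c)"
      by (auto simp: closed_segment_def)
    then obtain t where "0 \<le> t" "y = t *\<^sub>R (- e, c)"
      using \<open>0 \<le> R\<close> by (metis mult_nonneg_nonneg)
    with * have "0 \<le> t" "x = z + t *\<^sub>R e" "r = s + c * t" by (auto simp: algebra_simps)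
    then have "slope_reg P e c q z \<le> q x + ereal (c * t)"
      using slope_reg_le_shift[of t z e P c q] * by (auto simp: epi_on_def)
    also have "\<dots> \<le> ereal s + ereal (c * t)" using * by (intro add_mono) (auto simp: epi_on_def)
    finally show "(z, r) \<in> epi_on P (slope_reg P e c q)" using * \<open>r = s + c * t\<close> by (auto simp: epi_on_def)
  qed
  then show thesis using cl by (intro that) simp_all
qed

lemma lsc_on_slope_reg:
  assumes "compact P" "lsc_on P q" "e \<noteq> 0"
  shows "lsc_on P (slope_reg P e c q)"
  by (rule epi_on_slope_reg[OF assms]) (rule lsc_on_if_closed_epi_on)

lemma econvex_on_slope_reg:
  fixes P :: "'a::euclidean_space set"
  assumes "compact P" "convex P" "lsc_on P q" "econvex_on P q" "e \<noteq> 0" "0 \<le> c"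
    "\<And>x. x \<in> P \<Longrightarrow> q x \<noteq> -\<infinity>"
  shows "econvex_on P (slope_reg P e c q)"
proof (rule econvex_on_if_convex_epi_on)
  obtain R where "epi_on P (slope_reg P e c q) =
    (P \<times> UNIV) \<inter> (\<Union>x\<in>epi_on P q. \<Union>y\<in>closed_segment 0 (R *\<^sub>R (- e, c)). {x + y})"
    by (rule epi_on_slope_reg[OF assms(1,3,5)])
  then show "convex (epi_on P (slope_reg P e c q))"
    using assms by (auto intro!: convex_Int convex_sums convex_Times convex_epi_on)
  obtain m where "\<And>x. x \<in> P \<Longrightarrow> ereal m \<le> q x"
    by (rule lsc_on_compact_bounded_below[OF assms(1,3,7)]) blast+
  then show "slope_reg P e c q x \<noteq> -\<infinity>" for x
    using slope_reg_ge[of P m q c e x] assms(6) by auto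
qed

section \<open>The exponential as an order isomorphism from the extended reals onto the extended
  nonnegative reals\<close>

lemma eexp_mono: "x \<le> y \<Longrightarrow> eexp x \<le> eexp y"
  by (cases x; cases y) (auto simp: eexp_def)

lemma eexp_eln: "eexp (eln u) = u"
  by (cases u) (auto simp: eexp_def eln_def ennreal_eq_0_iff)

lemma eln_eexp: "eln (eexp x) = x"
  by (cases x) (auto simp: eexp_def eln_def ennreal_eq_0_iff)

lemma eexp_strict_mono: "x < y \<Longrightarrow> eexp x < eexp y"
  by (metis eexp_mono eln_eexp less_le)

lemma eexp_le_iff: "eexp x \<le> eexp y \<longleftrightarrow> x \<le> y"
  by (metis eexp_mono eexp_strict_mono leD leI)

lemma eexp_add: "eexp (x + ereal s) = ennreal (exp s) * eexp x"
  by (cases x) (auto simp: eexp_def exp_add ennreal_mult' mult.commute ennreal_mult_top)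

lemma eexp_eq_0_iff: "eexp x = 0 \<longleftrightarrow> x = -\<infinity>"
  by (auto simp: eexp_def ennreal_eq_0_iff)

lemma borel_measurable_eexp [measurable]: "eexp \<in> borel_measurable borel"
proof (rule borel_measurableI_le)
  fix y
  have "{x \<in> space borel. eexp x \<le> y} = {..eln y}"
    using eexp_le_iff[of _ "eln y"] by (auto simp: eexp_eln)
  then show "{x \<in> space borel. eexp x \<le> y} \<in> sets borel" by simp
qed

text \<open>Lower semicontinuity refers only to the order of the values, so an order isomorphism
  preserves it: the levels \<open>y\<close> are reindexed by \<open>eln y\<close>.\<close>

lemma lsc_on_eexp_iff: "lsc_on P (\<lambda>x. eexp (q x)) \<longleftrightarrow> lsc_on P q"
proof -
  have lt: "y < eexp a \<longleftrightarrow> eln y < a" for y a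
    using eexp_le_iff[of a "eln y"] by (simp add: eexp_eln not_le[symmetric])
  have reindex: "(\<forall>y. Q (eln y)) \<longleftrightarrow> (\<forall>y. Q y)" for Q
    by (metis eln_eexp)
  show ?thesis unfolding lsc_on_iff_nhds lt
    by (intro ball_cong refl
        reindex[of "\<lambda>y. y < q x \<longrightarrow> (\<exists>S. open S \<and> x \<in> S \<and> (\<forall>z\<in>S \<inter> P. y < q z))" for x])
qed

section \<open>Exponential decay of the gap between a function and its regularisation\<close>

text \<open>The case distinction gives 0 where both functions are \<infinity>; plain subtraction in
  \<open>ennreal\<close> would give \<open>\<infinity> - \<infinity> = \<infinity>\<close>
  there.\<close>

definition reg_gap :: "'a::real_normed_vector set \<Rightarrow> 'a \<Rightarrow> real \<Rightarrow> ('a \<Rightarrow> ereal) \<Rightarrow> 'a \<Rightarrow> ennreal" where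
  "reg_gap P e c q z =
     (if slope_reg P e c q z < q z then eexp (q z) - eexp (slope_reg P e c q z) else 0)"

lemma eexp_slope_reg_add_gap:
  "z \<in> P \<Longrightarrow> eexp (q z) = eexp (slope_reg P e c q z) + reg_gap P e c q z"
  using slope_reg_le[of z P e c q]
  by (auto simp: reg_gap_def not_less add_diff_inverse_ennreal eexp_mono)

text \<open>A competitor \<open>t\<close> at \<open>b + \<tau> *\<^sub>R e\<close> becomes the
  competitor \<open>\<tau> + t\<close> at \<open>b\<close>, at the extra cost
  \<open>c * \<tau>\<close>.\<close>

lemma slope_reg_along:
  "0 \<le> \<tau> \<Longrightarrow> slope_reg P e c q b \<le> slope_reg P e c q (b + \<tau> *\<^sub>R e) + ereal (c * \<tau>)"
proof -
  assume \<tau>: "0 \<le> \<tau>"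
  have "slope_reg P e c q b - ereal (c * \<tau>) \<le> slope_reg P e c q (b + \<tau> *\<^sub>R e)"
    unfolding slope_reg_def[of P e c q "b + \<tau> *\<^sub>R e"]
  proof (rule INF_greatest)
    fix t assume t: "t \<in> {t. 0 \<le> t \<and> b + \<tau> *\<^sub>R e + t *\<^sub>R e \<in> P}"
    have "slope_reg P e c q b \<le> q (b + \<tau> *\<^sub>R e + t *\<^sub>R e) + ereal (c * (\<tau> + t))"
      using slope_reg_le_shift[of "\<tau> + t" b e P c q] t \<tau> by (simp add: scaleR_add_left add.assoc)
    also have "\<dots> = q (b + \<tau> *\<^sub>R e + t *\<^sub>R e) + ereal (c * t) + ereal (c * \<tau>)"
      by (cases "q (b + \<tau> *\<^sub>R e + t *\<^sub>R e)") (auto simp: algebra_simps)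
    finally show "slope_reg P e c q b - ereal (c * \<tau>) \<le> q (b + \<tau> *\<^sub>R e + t *\<^sub>R e) + ereal (c * t)"
      by (simp add: ereal_minus_le)
  qed
  then show ?thesis by (simp add: ereal_minus_le)
qed

text \<open>Secant slopes of a convex function increase along a line. A secant of slope below
  \<open>- c\<close> starting at \<open>b + \<tau> *\<^sub>R e\<close> therefore forces slope at
  most \<open>- c\<close> on the stretch from \<open>b\<close> to that point.\<close>

lemma convex_slope_before:
  assumes "econvex_on P q" "\<And>x. x \<in> P \<Longrightarrow> q x \<noteq> -\<infinity>" "0 \<le> \<tau>" "0 < t"
    "b \<in> P" "b + (\<tau> + t) *\<^sub>R e \<in> P" "b + \<tau> *\<^sub>R e \<in> P"
    "q (b + (\<tau> + t) *\<^sub>R e) + ereal (c * t) < q (b + \<tau> *\<^sub>R e)"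
  shows "q (b + \<tau> *\<^sub>R e) + ereal (c * \<tau>) \<le> q b"
proof (cases "q b = \<infinity>")
  case False
  \<comment> \<open>The weight of the far point when \<open>b + \<tau> *\<^sub>R e\<close> is
    written as a convex combination of \<open>b\<close> and
    \<open>b + (\<tau> + t) *\<^sub>R e\<close>.\<close>
  define s where "s = \<tau> / (\<tau> + t)"
  have s: "0 \<le> s" "s < 1" "s * (\<tau> + t) = \<tau>" "(1 - s) * \<tau> = s * t"
    using assms(3,4) unfolding s_def by (auto simp: field_simps)
  obtain \<beta> where \<beta>: "q b = ereal \<beta>" using False assms(2)[OF assms(5)] by (cases "q b") auto
  have "b + \<tau> *\<^sub>R e = (1 - s) *\<^sub>R b + s *\<^sub>R (b + (\<tau> + t) *\<^sub>R e)"
    using s(3) by (simp add: algebra_simps flip: scaleR_add_left)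
  then have cv: "q (b + \<tau> *\<^sub>R e) \<le> ereal (1 - s) * ereal \<beta> + ereal s * q (b + (\<tau> + t) *\<^sub>R e)"
    using assms(1,5,6) s \<beta> unfolding econvex_on_def by (metis less_imp_le)
  show ?thesis
  proof (cases "q (b + (\<tau> + t) *\<^sub>R e)")
    case (real \<gamma>)
    with cv obtain \<zeta> where \<zeta>: "q (b + \<tau> *\<^sub>R e) = ereal \<zeta>"
      using assms(2)[OF assms(7)] by (cases "q (b + \<tau> *\<^sub>R e)") auto
    have "\<gamma> + c * t \<le> \<zeta>" "\<zeta> \<le> (1 - s) * \<beta> + s * \<gamma>" using cv assms(8) real \<zeta> by auto
    then have "s * (\<gamma> + c * t) \<le> s * \<zeta>" using s(1) by (intro mult_left_mono)
    then have "(1 - s) * \<zeta> + c * (s * t) \<le> (1 - s) * \<beta>"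
      using \<open>\<zeta> \<le> (1 - s) * \<beta> + s * \<gamma>\<close> by (simp add: algebra_simps)
    then have "(1 - s) * (\<zeta> + c * \<tau>) \<le> (1 - s) * \<beta>"
      unfolding s(4)[symmetric] by (simp add: algebra_simps)
    then show ?thesis using s(2) \<zeta> \<beta> by simp
  next
    case PInf
    then show ?thesis using assms(8) by simp
  next
    case MInf
    then show ?thesis using assms(2)[OF assms(6)] by simp
  qed
qed simp

text \<open>A positive gap at \<open>b + \<tau> *\<^sub>R e\<close> means that some secant ahead
  falls faster than \<open>c\<close>. Then \<open>q\<close> has already dropped by at least
  \<open>c * \<tau>\<close> since \<open>b\<close>, while the regularisation can have dropped by at
  most that amount. After exponentiating, the difference shrinks by the factor
  \<open>exp (- c * \<tau>)\<close>.\<close>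

lemma reg_gap_decay:
  assumes "econvex_on P q" "\<And>x. x \<in> P \<Longrightarrow> q x \<noteq> -\<infinity>" "0 \<le> \<tau>"
    "b \<in> P" "b + \<tau> *\<^sub>R e \<in> P"
  shows "reg_gap P e c q (b + \<tau> *\<^sub>R e) \<le> ennreal (exp (- c * \<tau>)) * reg_gap P e c q b"
proof (cases "slope_reg P e c q (b + \<tau> *\<^sub>R e) < q (b + \<tau> *\<^sub>R e)")
  case True
  let ?z = "b + \<tau> *\<^sub>R e" and ?r = "slope_reg P e c q"
  obtain t where t: "0 \<le> t" "?z + t *\<^sub>R e \<in> P" "q (?z + t *\<^sub>R e) + ereal (c * t) < q ?z"
    using True unfolding slope_reg_def INF_less_iff by auto
  then have "t \<noteq> 0" by (auto simp: zero_ereal_def[symmetric])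
  have qz: "q ?z + ereal (c * \<tau>) \<le> q b"
    using t \<open>t \<noteq> 0\<close> assms by (intro convex_slope_before[where t = t]) (auto simp: algebra_simps)
  \<comment> \<open>Besides bounding the subtracted term, this shows that the gap at
    \<open>b\<close> is positive too, so \<open>reg_gap\<close> is the difference at both
    points.\<close>
  have rz: "?r b \<le> ?r ?z + ereal (c * \<tau>)" by (rule slope_reg_along[OF assms(3)])
  also have "\<dots> < q ?z + ereal (c * \<tau>)"
    using True by (cases "?r ?z"; cases "q ?z") auto
  finally have rb: "?r b < q b" using qz by simp
  have "eexp (q ?z) - eexp (?r ?z) \<le> ennreal (exp (- c * \<tau>)) * eexp (q b) - ennreal (exp (- c * \<tau>)) * eexp (?r b)"
  proof (rule ennreal_minus_mono)
    have "q ?z \<le> q b + ereal (- c * \<tau>)" using qz by (cases "q ?z"; cases "q b") auto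
    then show "eexp (q ?z) \<le> ennreal (exp (- c * \<tau>)) * eexp (q b)" using eexp_add eexp_mono by metis
    have "?r b + ereal (- c * \<tau>) \<le> ?r ?z" using rz by (cases "?r ?z"; cases "?r b") auto
    then show "ennreal (exp (- c * \<tau>)) * eexp (?r b) \<le> eexp (?r ?z)" using eexp_add eexp_mono by metis
  qed
  also have "\<dots> = ennreal (exp (- c * \<tau>)) * (eexp (q b) - eexp (?r b))"
    by (simp add: ennreal_right_diff_distrib)
  finally show ?thesis using True rb by (simp add: reg_gap_def)
qed (simp add: reg_gap_def)

subsection \<open>Oblique coordinates in the plane\<close>

lemma
  fixes i j :: "'a::euclidean_space"
  assumes B: "Basis = {i, j}" "i \<noteq> j"
  shows inner_basis2: "i \<bullet> i = 1" "j \<bullet> j = 1" "i \<bullet> j = 0" "j \<bullet> i = 0"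
    and basis2_representation: "(v \<bullet> i) *\<^sub>R i + (v \<bullet> j) *\<^sub>R j = v"
proof -
  have "i \<in> Basis" "j \<in> Basis" using B by auto
  then show "i \<bullet> i = 1" "j \<bullet> j = 1" "i \<bullet> j = 0" "j \<bullet> i = 0"
    using B(2) by (simp_all add: inner_same_Basis inner_not_same_Basis)
  have "(\<Sum>b\<in>{i, j}. (v \<bullet> b) *\<^sub>R b) = v" unfolding B(1)[symmetric] by (rule euclidean_representation)
  then show "(v \<bullet> i) *\<^sub>R i + (v \<bullet> j) *\<^sub>R j = v" using B(2) by simp
qed

text \<open>The coordinate map from the plane pulls boxes back to boxes of the same area, which
  characterises \<open>lborel\<close>; the formula is then Tonelli's theorem.\<close>

lemma nn_integral_lborel_dim2:
  fixes f :: "'a::euclidean_space \<Rightarrow> ennreal"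
  assumes [measurable]: "f \<in> borel_measurable borel" and B: "Basis = {i, j :: 'a}" "i \<noteq> j"
  shows "(\<integral>\<^sup>+z. f z \<partial>lborel) = (\<integral>\<^sup>+x. \<integral>\<^sup>+y. f (x *\<^sub>R i + y *\<^sub>R j) \<partial>lborel \<partial>lborel)"
proof -
  let ?L = "\<lambda>p. fst p *\<^sub>R i + snd p *\<^sub>R j"
  note ij = inner_basis2[OF B]
  have [measurable]: "?L \<in> borel_measurable (borel :: (real \<times> real) measure)"
    by (intro borel_measurable_continuous_onI continuous_intros)
  have "lborel = distr (lborel :: (real \<times> real) measure) borel ?L"
  proof (rule lborel_eqI)
    fix l u :: 'a assume lu: "\<And>b. b \<in> Basis \<Longrightarrow> l \<bullet> b \<le> u \<bullet> b"
    have Bp: "Basis = {(1, 0), (0, 1) :: real \<times> real}" by (auto simp: Basis_prod_def)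
    have "?L -` box l u = box (l \<bullet> i, l \<bullet> j) (u \<bullet> i, u \<bullet> j)"
      unfolding box_def B(1) Bp by (auto simp: inner_add_left ij)
    moreover have "emeasure (distr lborel borel ?L) (box l u) = emeasure lborel (?L -` box l u \<inter> space lborel)"
      by (rule emeasure_distr) simp_all
    ultimately have "emeasure (distr lborel borel ?L) (box l u) = emeasure lborel (box (l \<bullet> i, l \<bullet> j) (u \<bullet> i, u \<bullet> j))"
      by (simp only: space_lborel space_borel Int_UNIV_right)
    also have "\<dots> = ennreal (\<Prod>b\<in>Basis. ((u \<bullet> i, u \<bullet> j) - (l \<bullet> i, l \<bullet> j)) \<bullet> b)"
    proof (rule emeasure_lborel_box)
      fix b :: "real \<times> real" assume "b \<in> Basis"
      then show "(l \<bullet> i, l \<bullet> j) \<bullet> b \<le> (u \<bullet> i, u \<bullet> j) \<bullet> b"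
        using lu[of i] lu[of j] unfolding B(1) Bp by auto
    qed
    also have "(\<Prod>b\<in>Basis. ((u \<bullet> i, u \<bullet> j) - (l \<bullet> i, l \<bullet> j)) \<bullet> b) = (\<Prod>b\<in>Basis. (u - l) \<bullet> b)"
      unfolding B(1) Bp using B(2) by (simp add: inner_diff_left)
    finally show "emeasure (distr lborel borel ?L) (box l u) = ennreal (\<Prod>b\<in>Basis. (u - l) \<bullet> b)" .
  qed simp
  then have "(\<integral>\<^sup>+z. f z \<partial>lborel) = (\<integral>\<^sup>+z. f z \<partial>distr (lborel :: (real \<times> real) measure) borel ?L)"
    by (rule arg_cong)
  also have "\<dots> = (\<integral>\<^sup>+p. f (?L p) \<partial>(lborel :: (real \<times> real) measure))"
    by (rule nn_integral_distr) simp_all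
  also have "\<dots> = (\<integral>\<^sup>+x. \<integral>\<^sup>+y. f (x *\<^sub>R i + y *\<^sub>R j) \<partial>lborel \<partial>lborel)"
    unfolding lborel_prod[symmetric] by (subst lborel.nn_integral_fst[symmetric]) simp_all
  finally show ?thesis .
qed

text \<open>Scaling the first coordinate by \<open>e \<bullet> i\<close> gives the factor, and for
  each fixed value of it the second coordinate is translated to complete
  \<open>\<tau> *\<^sub>R e\<close>. Tonelli's theorem then exchanges the two integrals.\<close>

lemma nn_integral_lborel_shear:
  fixes f :: "'a::euclidean_space \<Rightarrow> ennreal"
  assumes [measurable]: "f \<in> borel_measurable borel" and B: "Basis = {i, j :: 'a}" "i \<noteq> j" and e: "e \<bullet> i \<noteq> 0"
  shows "(\<integral>\<^sup>+z. f z \<partial>lborel) = ennreal \<bar>e \<bullet> i\<bar> * (\<integral>\<^sup>+y. \<integral>\<^sup>+\<tau>. f (y *\<^sub>R j + \<tau> *\<^sub>R e) \<partial>lborel \<partial>lborel)"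
proof -
  have e_eq: "e = (e \<bullet> i) *\<^sub>R i + (e \<bullet> j) *\<^sub>R j"
    using basis2_representation[OF B, of e] by simp
  have "(\<integral>\<^sup>+z. f z \<partial>lborel) = (\<integral>\<^sup>+x. \<integral>\<^sup>+y. f (x *\<^sub>R i + y *\<^sub>R j) \<partial>lborel \<partial>lborel)"
    by (rule nn_integral_lborel_dim2) fact+
  also have "\<dots> = ennreal \<bar>e \<bullet> i\<bar> * (\<integral>\<^sup>+\<tau>. \<integral>\<^sup>+y. f ((0 + (e \<bullet> i) * \<tau>) *\<^sub>R i + y *\<^sub>R j) \<partial>lborel \<partial>lborel)"
    by (rule nn_integral_real_affine) (use e in simp_all)
  also have "(\<integral>\<^sup>+\<tau>. \<integral>\<^sup>+y. f ((0 + (e \<bullet> i) * \<tau>) *\<^sub>R i + y *\<^sub>R j) \<partial>lborel \<partial>lborel) =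
      (\<integral>\<^sup>+\<tau>. \<integral>\<^sup>+y. f (y *\<^sub>R j + \<tau> *\<^sub>R e) \<partial>lborel \<partial>lborel)"
  proof (rule nn_integral_cong)
    fix \<tau> :: real
    have "(\<integral>\<^sup>+y. f ((0 + (e \<bullet> i) * \<tau>) *\<^sub>R i + y *\<^sub>R j) \<partial>lborel) =
        ennreal \<bar>1\<bar> * (\<integral>\<^sup>+y. f ((0 + (e \<bullet> i) * \<tau>) *\<^sub>R i + ((e \<bullet> j) * \<tau> + 1 * y) *\<^sub>R j) \<partial>lborel)"
      by (rule nn_integral_real_affine) simp_all
    also have "\<dots> = (\<integral>\<^sup>+y. f (y *\<^sub>R j + \<tau> *\<^sub>R ((e \<bullet> i) *\<^sub>R i + (e \<bullet> j) *\<^sub>R j)) \<partial>lborel)"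
      by (simp add: algebra_simps)
    finally show "(\<integral>\<^sup>+y. f ((0 + (e \<bullet> i) * \<tau>) *\<^sub>R i + y *\<^sub>R j) \<partial>lborel) = (\<integral>\<^sup>+y. f (y *\<^sub>R j + \<tau> *\<^sub>R e) \<partial>lborel)"
      using e_eq by simp
  qed
  also have "\<dots> = (\<integral>\<^sup>+y. \<integral>\<^sup>+\<tau>. f (y *\<^sub>R j + \<tau> *\<^sub>R e) \<partial>lborel \<partial>lborel)"
    by (rule lborel_pair.Fubini') measurable
  finally show ?thesis .
qed

text \<open>The factor is the absolute value of the determinant of \<open>e\<close> and
  \<open>d\<close> in the basis \<open>i\<close>, \<open>j\<close>. The inner integral runs along
  the lines in direction \<open>e\<close>, which is the form that the decay estimate needs.\<close>

lemma nn_integral_lborel_oblique: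
  fixes f :: "'a::euclidean_space \<Rightarrow> ennreal" and e d :: 'a
  assumes f [measurable]: "f \<in> borel_measurable borel" and B: "Basis = {i, j :: 'a}" "i \<noteq> j"
    and D: "(e \<bullet> i) * (d \<bullet> j) - (e \<bullet> j) * (d \<bullet> i) \<noteq> 0"
  shows "(\<integral>\<^sup>+z. f z \<partial>lborel) = ennreal \<bar>(e \<bullet> i) * (d \<bullet> j) - (e \<bullet> j) * (d \<bullet> i)\<bar> *
     (\<integral>\<^sup>+s. \<integral>\<^sup>+\<tau>. f (a + s *\<^sub>R d + \<tau> *\<^sub>R e) \<partial>lborel \<partial>lborel)"
proof -
  have *: "(\<integral>\<^sup>+z. f z \<partial>lborel) = ennreal \<bar>(e \<bullet> i) * (d \<bullet> j) - (e \<bullet> j) * (d \<bullet> i)\<bar> *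
     (\<integral>\<^sup>+s. \<integral>\<^sup>+\<tau>. f (a + s *\<^sub>R d + \<tau> *\<^sub>R e) \<partial>lborel \<partial>lborel)"
    if B: "Basis = {i, j :: 'a}" "i \<noteq> j" and e: "e \<bullet> i \<noteq> 0"
      and D: "(e \<bullet> i) * (d \<bullet> j) - (e \<bullet> j) * (d \<bullet> i) \<noteq> 0" for i j
  proof -
    \<comment> \<open>\<open>\<alpha> v\<close> and \<open>\<kappa> v\<close> are the coordinates of
      \<open>v\<close> in the basis \<open>e\<close>, \<open>j\<close>. The determinant factors as
      \<open>e \<bullet> i\<close>, which comes from the shear, times \<open>\<kappa> d\<close>,
      which comes from replacing the variable along \<open>j\<close> by \<open>s\<close>.\<close>
    define \<kappa> where "\<kappa> v = v \<bullet> j - (v \<bullet> i) / (e \<bullet> i) * (e \<bullet> j)" for v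
    define \<alpha> where "\<alpha> v = (v \<bullet> i) / (e \<bullet> i)" for v
    have split: "v = \<alpha> v *\<^sub>R e + \<kappa> v *\<^sub>R j" for v
    proof -
      have "\<alpha> v *\<^sub>R ((e \<bullet> i) *\<^sub>R i + (e \<bullet> j) *\<^sub>R j) + \<kappa> v *\<^sub>R j = (v \<bullet> i) *\<^sub>R i + (v \<bullet> j) *\<^sub>R j"
        using e by (simp add: \<alpha>_def \<kappa>_def scaleR_add_right flip: scaleR_add_left)
      then show ?thesis
        unfolding basis2_representation[OF B] by simp
    qed
    have D_eq: "(e \<bullet> i) * (d \<bullet> j) - (e \<bullet> j) * (d \<bullet> i) = (e \<bullet> i) * \<kappa> d"
      using e by (simp add: \<kappa>_def field_simps)
    have "(\<integral>\<^sup>+z. f z \<partial>lborel) = ennreal \<bar>e \<bullet> i\<bar> * (\<integral>\<^sup>+y. \<integral>\<^sup>+\<tau>. f (y *\<^sub>R j + \<tau> *\<^sub>R e) \<partial>lborel \<partial>lborel)"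
      by (rule nn_integral_lborel_shear) fact+
    also have "(\<integral>\<^sup>+y. \<integral>\<^sup>+\<tau>. f (y *\<^sub>R j + \<tau> *\<^sub>R e) \<partial>lborel \<partial>lborel) =
        ennreal \<bar>\<kappa> d\<bar> * (\<integral>\<^sup>+s. \<integral>\<^sup>+\<tau>. f ((\<kappa> a + \<kappa> d * s) *\<^sub>R j + \<tau> *\<^sub>R e) \<partial>lborel \<partial>lborel)"
      by (rule nn_integral_real_affine) (use D D_eq in simp_all)
    also have "(\<integral>\<^sup>+s. \<integral>\<^sup>+\<tau>. f ((\<kappa> a + \<kappa> d * s) *\<^sub>R j + \<tau> *\<^sub>R e) \<partial>lborel \<partial>lborel) =
        (\<integral>\<^sup>+s. \<integral>\<^sup>+\<tau>. f (a + s *\<^sub>R d + \<tau> *\<^sub>R e) \<partial>lborel \<partial>lborel)"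
    proof (rule nn_integral_cong)
      fix s :: real
      \<comment> \<open>The component of \<open>a + s *\<^sub>R d\<close> along \<open>e\<close> is
        absorbed by a translation of \<open>\<tau>\<close>.\<close>
      have "(\<integral>\<^sup>+\<tau>. f ((\<kappa> a + \<kappa> d * s) *\<^sub>R j + \<tau> *\<^sub>R e) \<partial>lborel) =
          ennreal \<bar>1\<bar> * (\<integral>\<^sup>+\<tau>. f ((\<kappa> a + \<kappa> d * s) *\<^sub>R j + (\<alpha> a + \<alpha> d * s + 1 * \<tau>) *\<^sub>R e) \<partial>lborel)"
        by (rule nn_integral_real_affine) simp_all
      also have "(\<lambda>\<tau>. (\<kappa> a + \<kappa> d * s) *\<^sub>R j + (\<alpha> a + \<alpha> d * s + 1 * \<tau>) *\<^sub>R e) = (\<lambda>\<tau>. (\<alpha> a *\<^sub>R e + \<kappa> a *\<^sub>R j) + s *\<^sub>R (\<alpha> d *\<^sub>R e + \<kappa> d *\<^sub>R j) + \<tau> *\<^sub>R e)"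
        by (simp add: algebra_simps)
      then have "(\<integral>\<^sup>+\<tau>. f ((\<kappa> a + \<kappa> d * s) *\<^sub>R j + (\<alpha> a + \<alpha> d * s + 1 * \<tau>) *\<^sub>R e) \<partial>lborel) =
          (\<integral>\<^sup>+\<tau>. f (a + s *\<^sub>R d + \<tau> *\<^sub>R e) \<partial>lborel)"
        unfolding split[symmetric] by metis
      finally show "(\<integral>\<^sup>+\<tau>. f ((\<kappa> a + \<kappa> d * s) *\<^sub>R j + \<tau> *\<^sub>R e) \<partial>lborel) = (\<integral>\<^sup>+\<tau>. f (a + s *\<^sub>R d + \<tau> *\<^sub>R e) \<partial>lborel)"
        by simp
    qed
    finally show ?thesis unfolding D_eq by (simp add: abs_mult ennreal_mult mult.assoc)
  qed
  show ?thesis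
  proof (cases "e \<bullet> i = 0")
    case False
    then show ?thesis using * B D by blast
  next
    case True
    then have "e \<bullet> j \<noteq> 0" using D by auto
    \<comment> \<open>Exchanging \<open>i\<close> and \<open>j\<close> only changes the sign of the
      determinant, so the case already treated applies.\<close>
    then have "(\<integral>\<^sup>+z. f z \<partial>lborel) = ennreal \<bar>(e \<bullet> j) * (d \<bullet> i) - (e \<bullet> i) * (d \<bullet> j)\<bar> *
       (\<integral>\<^sup>+s. \<integral>\<^sup>+\<tau>. f (a + s *\<^sub>R d + \<tau> *\<^sub>R e) \<partial>lborel \<partial>lborel)"
      using B D by (intro *) auto
    then show ?thesis by (simp add: abs_minus_commute)
  qed
qed

text \<open>With a vanishing determinant all these points lie on the line through \<open>a\<close>
  in direction \<open>d\<close>, which is a null set.\<close>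

lemma AE_not_in_parallel_line:
  fixes e d :: "'a::euclidean_space"
  assumes B: "Basis = {i, j :: 'a}" "i \<noteq> j" and "d \<noteq> 0"
    and D: "(e \<bullet> i) * (d \<bullet> j) - (e \<bullet> j) * (d \<bullet> i) = 0"
  shows "AE z in lborel. \<nexists>s \<tau>. z = a + s *\<^sub>R d + \<tau> *\<^sub>R e"
proof -
  \<comment> \<open>\<open>d\<close> turned by a right angle: it is orthogonal to \<open>d\<close>,
    and also to \<open>e\<close> because the determinant vanishes.\<close>
  define n where "n = (d \<bullet> j) *\<^sub>R i - (d \<bullet> i) *\<^sub>R j"
  note ij = inner_basis2[OF B]
  have "n \<noteq> 0"
  proof
    assume "n = 0"
    then have "n \<bullet> i = 0" "n \<bullet> j = 0" by auto
    then show False using \<open>d \<noteq> 0\<close> basis2_representation[OF B, of d] by (simp add: n_def ij inner_diff_left)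
  qed
  then have "{z. n \<bullet> z = n \<bullet> a} \<in> null_sets lborel"
    using negligible_hyperplane[of n "n \<bullet> a"]
    by (simp add: negligible_iff_null_sets null_sets_completion_iff)
  then have AE: "AE z in lborel. z \<notin> {z. n \<bullet> z = n \<bullet> a}" by (rule AE_not_in)
  have "n \<bullet> d = 0" "n \<bullet> e = 0"
    using D by (simp_all add: n_def inner_diff_left inner_commute[of i] inner_commute[of j] algebra_simps)
  then have "n \<bullet> (a + s *\<^sub>R d + \<tau> *\<^sub>R e) = n \<bullet> a" for s \<tau>
    by (simp add: inner_add_right)
  then show ?thesis
    using AE by (elim eventually_mono) blast
qed

lemma nn_integral_exp_decay:
  assumes "c > 0"
  shows "(\<integral>\<^sup>+\<tau>. ennreal (exp (- c * \<tau>)) * indicator {0..} \<tau> \<partial>lborel) = ennreal (1 / c)"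
proof -
  have "(\<integral>\<^sup>+\<tau>. ennreal (exp (- c * \<tau>)) * indicator {0..} \<tau> \<partial>lborel) = 0 - (- exp (- c * 0) / c)"
  proof (rule nn_integral_FTC_atLeast)
    show "((\<lambda>\<tau>. - exp (- c * \<tau>) / c) has_real_derivative exp (- c * x)) (at x)" for x
      using assms by (auto intro!: derivative_eq_intros)
    have "((\<lambda>\<tau>. exp (- c * \<tau>)) \<longlongrightarrow> 0) at_top"
      using assms by (intro filterlim_compose[OF exp_at_bot] filterlim_tendsto_neg_mult_at_bot[OF tendsto_const] filterlim_ident) auto
    then have "((\<lambda>\<tau>. - exp (- c * \<tau>) / c) \<longlongrightarrow> - 0 / c) at_top"
      using assms by (intro tendsto_divide tendsto_minus tendsto_const) auto
    then show "((\<lambda>\<tau>. - exp (- c * \<tau>) / c) \<longlongrightarrow> 0) at_top" by simp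
  qed auto
  then show ?thesis by simp
qed

text \<open>The hypothesis on Borel sets says that \<open>\<sigma>\<close> restricted to
  \<open>F\<close> is a multiple of the image of Lebesgue measure under the parametrisation,
  restricted to \<open>F\<close>. Equality of these measures transfers to integrals.\<close>

lemma nn_integral_indicator_along_line:
  fixes f :: "'a::real_normed_vector \<Rightarrow> ennreal"
  assumes f: "f \<in> borel_measurable borel" and F: "F \<in> sets borel" and "sets \<sigma> = sets borel"
    and \<sigma>: "\<And>A. A \<in> sets borel \<Longrightarrow> emeasure \<sigma> (A \<inter> F) =
               ennreal c * emeasure lborel ((\<lambda>t::real. a + t *\<^sub>R d) -` (A \<inter> F))"
  shows "(\<integral>\<^sup>+z. f z * indicator F z \<partial>\<sigma>) =
    ennreal c * (\<integral>\<^sup>+t. f (a + t *\<^sub>R d) * indicator F (a + t *\<^sub>R d) \<partial>lborel)"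
proof -
  note [measurable] = f F
  have [measurable_cong]: "sets \<sigma> = sets borel" by fact
  have [measurable]: "(\<lambda>t::real. a + t *\<^sub>R d) \<in> borel_measurable borel"
    by (intro borel_measurable_continuous_onI continuous_intros)
  let ?L = "distr lborel borel (\<lambda>t::real. a + t *\<^sub>R d)"
  have "density \<sigma> (indicator F) = density ?L (\<lambda>x. ennreal c * indicator F x)"
  proof (rule measure_eqI)
    fix A assume "A \<in> sets (density \<sigma> (indicator F))"
    then have A [measurable]: "A \<in> sets borel" using assms(3) by simp
    have "emeasure (density \<sigma> (indicator F)) A = (\<integral>\<^sup>+x. indicator (A \<inter> F) x \<partial>\<sigma>)"
      by (subst emeasure_density) (auto simp: assms(3) indicator_inter_arith mult.commute simp del: nn_integral_indicator intro!: nn_integral_cong)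
    also have "\<dots> = ennreal c * emeasure lborel ((\<lambda>t::real. a + t *\<^sub>R d) -` (A \<inter> F))"
      using \<sigma>[OF A] by (simp add: assms(3))
    also have "\<dots> = ennreal c * emeasure ?L (A \<inter> F)"
      by (subst emeasure_distr) auto
    also have "\<dots> = (\<integral>\<^sup>+x. ennreal c * indicator (A \<inter> F) x \<partial>?L)"
      by (subst nn_integral_cmult) auto
    also have "\<dots> = emeasure (density ?L (\<lambda>x. ennreal c * indicator F x)) A"
      by (subst emeasure_density) (auto simp: indicator_inter_arith mult_ac)
    finally show "emeasure (density \<sigma> (indicator F)) A = emeasure (density ?L (\<lambda>x. ennreal c * indicator F x)) A" .
  qed (simp add: assms(3))
  then have "(\<integral>\<^sup>+z. f z \<partial>density \<sigma> (indicator F)) = (\<integral>\<^sup>+z. f z \<partial>density ?L (\<lambda>x. ennreal c * indicator F x))"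
    by simp
  then show ?thesis
    by (simp add: nn_integral_density nn_integral_distr nn_integral_cmult mult_ac)
qed

subsection \<open>Comparison of interior and boundary integrals\<close>

text \<open>Moving back from \<open>z\<close> along \<open>- e\<close>, the last parameter at which
  the line is still in \<open>P\<close> exists by compactness. At an interior point one could move
  further.\<close>

lemma entry_point_in_frontier:
  fixes P :: "'a::euclidean_space set"
  assumes "compact P" "z \<in> P" "e \<noteq> 0"
  obtains \<tau> where "0 \<le> \<tau>" "z - \<tau> *\<^sub>R e \<in> frontier P"
proof -
  define S where "S = {0..} \<inter> (\<lambda>\<tau>. z - \<tau> *\<^sub>R e) -` P"
  have "closed S" unfolding S_def
    using assms(1) by (intro closed_Int closed_vimage compact_imp_closed continuous_intros) auto
  moreover have "bounded S"
  proof -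
    obtain B where B: "\<And>x. x \<in> P \<Longrightarrow> norm x \<le> B"
      using compact_imp_bounded[OF assms(1)] bounded_iff by blast
    have "\<bar>\<tau>\<bar> \<le> 2 * B / norm e" if "\<tau> \<in> S" for \<tau>
    proof -
      have "\<bar>\<tau>\<bar> * norm e = norm (z - (z - \<tau> *\<^sub>R e))" by simp
      also have "\<dots> \<le> B + B"
        using that B[OF assms(2)] B[of "z - \<tau> *\<^sub>R e"] norm_triangle_ineq4[of z "z - \<tau> *\<^sub>R e"]
        unfolding S_def by auto
      finally show ?thesis using assms(3) by (simp add: field_simps)
    qed
    then show ?thesis unfolding bounded_iff real_norm_def by blast
  qed
  moreover have "0 \<in> S" using assms(2) by (simp add: S_def)
  ultimately obtain \<tau> where \<tau>: "\<tau> \<in> S" "\<And>s. s \<in> S \<Longrightarrow> s \<le> \<tau>"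
    using compact_attains_sup[of S] by (auto simp: compact_eq_bounded_closed)
  have "z - \<tau> *\<^sub>R e \<notin> interior P"
  proof
    assume "z - \<tau> *\<^sub>R e \<in> interior P"
    then obtain r where r: "r > 0" "cball (z - \<tau> *\<^sub>R e) r \<subseteq> P" using mem_interior_cball by blast
    \<comment> \<open>A further step of length exactly \<open>r\<close>, which stays in the closed
      ball.\<close>
    have eq: "z - (\<tau> + r / norm e) *\<^sub>R e = (z - \<tau> *\<^sub>R e) - (r / norm e) *\<^sub>R e"
      by (simp add: algebra_simps)
    have "(z - \<tau> *\<^sub>R e) - (r / norm e) *\<^sub>R e \<in> cball (z - \<tau> *\<^sub>R e) r"
      using assms(3) r(1) by (simp add: dist_norm)
    then have "z - (\<tau> + r / norm e) *\<^sub>R e \<in> P" using r(2) unfolding eq by blast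
    moreover have "0 \<le> \<tau> + r / norm e" using r(1) \<tau>(1) by (simp add: S_def)
    ultimately have "\<tau> + r / norm e \<in> S" by (simp add: S_def)
    moreover have "0 < r / norm e" using r(1) assms(3) by simp
    ultimately show False using \<tau>(2)[of "\<tau> + r / norm e"] by simp
  qed
  then show thesis using \<tau>(1) closure_subset[of P] by (intro that[of \<tau>]) (auto simp: S_def frontier_def)
qed

text \<open>The set swept out of \<open>F\<close> in direction \<open>e\<close> is the sum of a
  closed ray and a compact set. Closedness is what makes it measurable below.\<close>

lemma closed_behind:
  fixes F :: "'a::euclidean_space set"
  assumes "compact F" "e \<noteq> 0"
  shows "closed {z. \<exists>\<tau>\<ge>0. z - \<tau> *\<^sub>R e \<in> F}"
proof -
  have "{z. \<exists>\<tau>\<ge>0. z - \<tau> *\<^sub>R e \<in> F} = (\<Union>x\<in>(\<lambda>\<tau>. \<tau> *\<^sub>R e) ` {0..}. \<Union>y\<in>F. {x + y})"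
  proof (intro equalityI subsetI)
    fix z assume "z \<in> {z. \<exists>\<tau>\<ge>0. z - \<tau> *\<^sub>R e \<in> F}"
    then obtain \<tau> where "0 \<le> \<tau>" "z - \<tau> *\<^sub>R e \<in> F" by blast
    then show "z \<in> (\<Union>x\<in>(\<lambda>\<tau>. \<tau> *\<^sub>R e) ` {0..}. \<Union>y\<in>F. {x + y})"
      by (intro UN_I[of "\<tau> *\<^sub>R e"] UN_I[of "z - \<tau> *\<^sub>R e"]) auto
  next
    fix z assume "z \<in> (\<Union>x\<in>(\<lambda>\<tau>. \<tau> *\<^sub>R e) ` {0..}. \<Union>y\<in>F. {x + y})"
    then obtain \<tau> y where "0 \<le> \<tau>" "y \<in> F" "z = \<tau> *\<^sub>R e + y" by auto
    then show "z \<in> {z. \<exists>\<tau>\<ge>0. z - \<tau> *\<^sub>R e \<in> F}" by (intro CollectI exI[of _ \<tau>]) auto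
  qed
  moreover have "closed ((\<lambda>\<tau>. \<tau> *\<^sub>R e) ` {0::real..})"
    using assms(2) by (intro closed_injective_linear_image) (auto intro: linearI inj_onI simp: algebra_simps)
  ultimately show ?thesis using closed_compact_sums[OF _ assms(1)] by (simp only:)
qed

text \<open>In oblique coordinates the value at a point swept from the segment is bounded by its
  value on the segment times \<open>exp (- k * \<tau>)\<close>. Integrating the exponential gives
  \<open>1 / k\<close>, and the determinant is at most \<open>2 * norm e\<close>. If
  \<open>e\<close> is parallel to the segment, the swept set is null.\<close>

lemma nn_integral_behind_segment_le:
  fixes g :: "'a::euclidean_space \<Rightarrow> ennreal"
  assumes g [measurable]: "g \<in> borel_measurable borel" and B: "Basis = {i, j :: 'a}" "i \<noteq> j"
    and F: "compact F" "F \<subseteq> range (\<lambda>t::real. a + t *\<^sub>R d)" "norm d = 1"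
    and e: "e \<noteq> 0" and k: "k > 0"
    and decay: "\<And>b \<tau>. b \<in> F \<Longrightarrow> 0 \<le> \<tau> \<Longrightarrow> g (b + \<tau> *\<^sub>R e) \<le> ennreal (exp (- k * \<tau>)) * g b"
  shows "(\<integral>\<^sup>+z. g z * indicator {z. \<exists>\<tau>\<ge>0. z - \<tau> *\<^sub>R e \<in> F} z \<partial>lborel) \<le>
    ennreal (2 * norm e / k) * (\<integral>\<^sup>+s. g (a + s *\<^sub>R d) * indicator F (a + s *\<^sub>R d) \<partial>lborel)"
proof -
  let ?S = "{z. \<exists>\<tau>\<ge>0. z - \<tau> *\<^sub>R e \<in> F}"
  let ?D = "(e \<bullet> i) * (d \<bullet> j) - (e \<bullet> j) * (d \<bullet> i)"
  show ?thesis
  proof (cases "?D = 0")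
    case True
    have "d \<noteq> 0" using F(3) by auto
    have "AE z in lborel. g z * indicator ?S z = 0"
    proof (rule eventually_mono[OF AE_not_in_parallel_line[OF B \<open>d \<noteq> 0\<close> True, of a]])
      fix z assume *: "\<nexists>s \<tau>. z = a + s *\<^sub>R d + \<tau> *\<^sub>R e"
      have "z \<notin> ?S"
      proof
        assume "z \<in> ?S"
        then obtain \<tau> s where "z - \<tau> *\<^sub>R e = a + s *\<^sub>R d" using F(2) by blast
        then have "z = a + s *\<^sub>R d + \<tau> *\<^sub>R e" by (simp add: algebra_simps)
        with * show False by blast
      qed
      then show "g z * indicator ?S z = 0" by simp
    qed
    then have "(\<integral>\<^sup>+z. g z * indicator ?S z \<partial>lborel) = (\<integral>\<^sup>+z. 0 \<partial>(lborel :: 'a measure))"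
      by (rule nn_integral_cong_AE)
    then show ?thesis by simp
  next
    case False
    have S [measurable]: "?S \<in> sets borel" using closed_behind[OF F(1) e] by simp
    have [measurable]: "F \<in> sets borel" using F(1) by (simp add: borel_compact)
    have [measurable]: "(\<lambda>s::real. a + s *\<^sub>R d) \<in> borel_measurable borel"
      by (intro borel_measurable_continuous_onI continuous_intros)
    let ?h = "\<lambda>s. g (a + s *\<^sub>R d) * indicator F (a + s *\<^sub>R d)"
    \<comment> \<open>Linear independence of \<open>e\<close> and \<open>d\<close> makes the source
      point on the segment unique. Hence the swept set is described by \<open>0 \<le> \<tau>\<close>
      and \<open>a + s *\<^sub>R d \<in> F\<close>.\<close>
    have pt: "g (a + s *\<^sub>R d + \<tau> *\<^sub>R e) * indicator ?S (a + s *\<^sub>R d + \<tau> *\<^sub>R e) \<le>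
        ?h s * (ennreal (exp (- k * \<tau>)) * indicator {0..} \<tau>)" for s \<tau>
    proof (cases "a + s *\<^sub>R d + \<tau> *\<^sub>R e \<in> ?S")
      case True
      then obtain \<tau>' s' where *: "0 \<le> \<tau>'" "a + s *\<^sub>R d + \<tau> *\<^sub>R e - \<tau>' *\<^sub>R e \<in> F"
        "a + s *\<^sub>R d + \<tau> *\<^sub>R e - \<tau>' *\<^sub>R e = a + s' *\<^sub>R d" using F(2) by blast
      then have "(\<tau> - \<tau>') *\<^sub>R e = (s' - s) *\<^sub>R d" by (simp add: algebra_simps)
      then have ij: "(\<tau> - \<tau>') * (e \<bullet> v) = (s' - s) * (d \<bullet> v)" for v by (metis inner_scaleR_left)
      have "(\<tau> - \<tau>') * ?D = ((\<tau> - \<tau>') * (e \<bullet> i)) * (d \<bullet> j) - ((\<tau> - \<tau>') * (e \<bullet> j)) * (d \<bullet> i)"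
        by (simp add: algebra_simps)
      also have "\<dots> = 0" unfolding ij by simp
      finally have "\<tau>' = \<tau>" using False by simp
      with * have "0 \<le> \<tau>" "a + s *\<^sub>R d \<in> F" by simp_all
      then show ?thesis using decay[of "a + s *\<^sub>R d" \<tau>] True by (simp add: mult.commute)
    qed simp
    have "(\<integral>\<^sup>+z. g z * indicator ?S z \<partial>lborel) = ennreal \<bar>?D\<bar> *
        (\<integral>\<^sup>+s. \<integral>\<^sup>+\<tau>. g (a + s *\<^sub>R d + \<tau> *\<^sub>R e) * indicator ?S (a + s *\<^sub>R d + \<tau> *\<^sub>R e) \<partial>lborel \<partial>lborel)"
      by (rule nn_integral_lborel_oblique[OF _ B False]) measurable
    also have "\<dots> \<le> ennreal \<bar>?D\<bar> * (\<integral>\<^sup>+s. \<integral>\<^sup>+\<tau>. ?h s * (ennreal (exp (- k * \<tau>)) * indicator {0..} \<tau>) \<partial>lborel \<partial>lborel)"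
      by (intro mult_left_mono nn_integral_mono pt) simp
    also have "\<dots> = ennreal \<bar>?D\<bar> * (\<integral>\<^sup>+s. ?h s * ennreal (1 / k) \<partial>lborel)"
      by (subst nn_integral_cmult) (measurable, simp only: nn_integral_exp_decay[OF k])
    also have "\<dots> = ennreal (\<bar>?D\<bar> * (1 / k)) * (\<integral>\<^sup>+s. ?h s \<partial>lborel)"
      using k by (subst nn_integral_multc, measurable, subst ennreal_mult) (auto simp: mult_ac)
    also have "\<dots> \<le> ennreal (2 * norm e / k) * (\<integral>\<^sup>+s. ?h s \<partial>lborel)"
    proof (intro mult_right_mono ennreal_leI)
      have "\<bar>v \<bullet> i\<bar> \<le> norm v" "\<bar>v \<bullet> j\<bar> \<le> norm v" for v
        using B(1) by (auto intro: Basis_le_norm)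
      then have "\<bar>(e \<bullet> i) * (d \<bullet> j)\<bar> \<le> norm e * norm d" "\<bar>(e \<bullet> j) * (d \<bullet> i)\<bar> \<le> norm e * norm d"
        unfolding abs_mult by (auto intro!: mult_mono)
      then have "\<bar>?D\<bar> \<le> 2 * norm e" using F(3) by simp
      then show "\<bar>?D\<bar> * (1 / k) \<le> 2 * norm e / k" using k by (simp add: divide_right_mono)
    qed simp
    finally show ?thesis .
  qed
qed

lemma compact_facet_of:
  fixes P :: "'a::euclidean_space set"
  shows "F facet_of P \<Longrightarrow> compact P \<Longrightarrow> convex P \<Longrightarrow> compact F"
  by (rule face_of_imp_compact[OF _ _ facet_of_imp_face_of])

text \<open>The last claim rests on the nonempty interior: the relative frontier of a polyhedron is
  the union of its facets, and here it equals the frontier.\<close>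

lemma system2D:
  fixes P :: "'a::euclidean_space set"
  assumes "system2 P \<mu> \<sigma>"
  shows "polyhedron P" "compact P" "convex P" "closed P" "P \<in> sets borel" "interior P \<noteq> {}" "DIM('a) = 2" "sets \<sigma> = sets borel"
    "finite {F. F facet_of P}" "\<Union>{F. F facet_of P} = frontier P"
proof -
  show P: "polyhedron P" "compact P" "interior P \<noteq> {}" "DIM('a) = 2" "sets \<sigma> = sets borel"
    using assms unfolding system2_def simple_polytope_def by auto
  show "convex P" by (rule polyhedron_imp_convex[OF P(1)])
  show "closed P" "P \<in> sets borel" using P(2) by (simp_all add: compact_imp_closed borel_compact)
  show "finite {F. F facet_of P}" by (rule finite_polyhedron_facets[OF P(1)])
  show "\<Union>{F. F facet_of P} = frontier P"
    using rel_frontier_of_polyhedron[OF P(1)] rel_frontier_nonempty_interior[OF P(3)] by simp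
qed

lemma borel_measurable_reg_gap:
  fixes P :: "'a::euclidean_space set"
  assumes "compact P" "lsc_on P q" "e \<noteq> 0"
  shows "(\<lambda>z. reg_gap P e c q z * indicator P z) \<in> borel_measurable borel"
proof -
  note [measurable] = borel_measurable_lsc_on[OF compact_imp_closed[OF assms(1)] assms(2)]
    borel_measurable_lsc_on[OF compact_imp_closed[OF assms(1)] lsc_on_slope_reg[OF assms, of c]]
  let ?Q = "\<lambda>x. if x \<in> P then q x else \<infinity>"
  let ?R = "\<lambda>x. if x \<in> P then slope_reg P e c q x else \<infinity>"
  have "(\<lambda>z. reg_gap P e c q z * indicator P z) = (\<lambda>z. if ?R z < ?Q z then eexp (?Q z) - eexp (?R z) else 0)"
    by (auto simp: reg_gap_def fun_eq_iff)
  then show ?thesis by (simp only:) measurable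
qed

text \<open>Every point of \<open>P\<close> is swept from some facet, and the gap decays along the
  way, so the segment estimate is summed over the facets. The slope is taken as
  \<open>c * norm e\<close> so that \<open>norm e\<close> cancels and \<open>C\<close> depends
  neither on the function nor on the direction.\<close>

lemma nn_integral_reg_gap_le:
  fixes P :: "'a::euclidean_space set"
  assumes sys: "system2 P \<mu> \<sigma>"
  obtains C where "C > 0" "\<And>q e c. lsc_on P q \<Longrightarrow> econvex_on P q \<Longrightarrow> (\<And>x. x \<in> P \<Longrightarrow> q x \<noteq> -\<infinity>) \<Longrightarrow>
     e \<noteq> 0 \<Longrightarrow> c > 0 \<Longrightarrow>
     (\<integral>\<^sup>+z\<in>P. reg_gap P e (c * norm e) q z \<partial>lborel) \<le>
       ennreal (C / c) * (\<integral>\<^sup>+z\<in>P. reg_gap P e (c * norm e) q z \<partial>\<sigma>)"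
proof -
  note P = system2D[OF sys]
  obtain i j :: 'a where B: "Basis = {i, j}" "i \<noteq> j"
    using P(7) by (metis card_2_iff)
  have "\<forall>F. \<exists>c a d. F facet_of P \<longrightarrow> c > 0 \<and> norm d = 1 \<and> F \<subseteq> range (\<lambda>t::real. a + t *\<^sub>R d) \<and>
           (\<forall>A\<in>sets borel. emeasure \<sigma> (A \<inter> F) =
               ennreal c * emeasure lborel ((\<lambda>t::real. a + t *\<^sub>R d) -` (A \<inter> F)))"
    using sys unfolding system2_def by metis
  then obtain cF :: "'a set \<Rightarrow> real" and aF dF where F: "\<And>F. F facet_of P \<Longrightarrow> cF F > 0 \<and> norm (dF F) = 1 \<and>
      F \<subseteq> range (\<lambda>t::real. aF F + t *\<^sub>R dF F) \<and>
      (\<forall>A\<in>sets borel. emeasure \<sigma> (A \<inter> F) =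
        ennreal (cF F) * emeasure lborel ((\<lambda>t::real. aF F + t *\<^sub>R dF F) -` (A \<inter> F)))"
    unfolding choice_iff by blast
  \<comment> \<open>Each facet contributes 2 from the segment estimate, divided by the density
    \<open>cF F\<close> that relates arc length to \<open>\<sigma>\<close>. The summand 1 guarantees
    positivity.\<close>
  define C where "C = 1 + (\<Sum>F | F facet_of P. 2 / cF F)"
  have Cpos: "0 \<le> (\<Sum>F | F facet_of P. 2 / cF F)"
    using F by (intro sum_nonneg) (auto intro: less_imp_le)
  show thesis
  proof (rule that)
    show "C > 0" using Cpos unfolding C_def by simp
    fix q and e :: 'a and c :: real
    assume q: "lsc_on P q" "econvex_on P q" "\<And>x. x \<in> P \<Longrightarrow> q x \<noteq> -\<infinity>" and e: "e \<noteq> 0" and c: "c > 0"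
    define g where "g z = reg_gap P e (c * norm e) q z * indicator P z" for z
    have g [measurable]: "g \<in> borel_measurable borel"
      unfolding g_def by (rule borel_measurable_reg_gap[OF P(2) q(1) e])
    have ce: "c * norm e > 0" using c e by simp
    let ?S = "\<lambda>F. {z. \<exists>\<tau>\<ge>0. z - \<tau> *\<^sub>R e \<in> F}"
    \<comment> \<open>Only an inequality, since a line may meet several facets behind
      \<open>z\<close>.\<close>
    have "g z \<le> (\<Sum>F | F facet_of P. g z * indicator (?S F) z)" for z
    proof (cases "z \<in> P")
      case True
      obtain \<tau> where \<tau>: "0 \<le> \<tau>" "z - \<tau> *\<^sub>R e \<in> frontier P"
        by (rule entry_point_in_frontier[OF P(2) True e])
      then obtain F where "F facet_of P" "z - \<tau> *\<^sub>R e \<in> F" using P(10) by blast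
      moreover from this have "z \<in> ?S F" using \<tau>(1) by blast
      ultimately have "g z = g z * indicator (?S F) z" "F \<in> {F. F facet_of P}" by auto
      then show ?thesis using member_le_sum[of F "{F. F facet_of P}" "\<lambda>F. g z * indicator (?S F) z"] P(9) by simp
    qed (simp add: g_def)
    then have "(\<integral>\<^sup>+z. g z \<partial>lborel) \<le> (\<integral>\<^sup>+z. (\<Sum>F | F facet_of P. g z * indicator (?S F) z) \<partial>lborel)"
      by (intro nn_integral_mono)
    also have "\<dots> = (\<Sum>F | F facet_of P. \<integral>\<^sup>+z. g z * indicator (?S F) z \<partial>lborel)"
    proof (rule nn_integral_sum)
      fix F assume "F \<in> {F. F facet_of P}"
      then have "closed (?S F)" using closed_behind[OF compact_facet_of e] P by blast
      then have [measurable]: "?S F \<in> sets borel" by simp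
      show "(\<lambda>z. g z * indicator (?S F) z) \<in> borel_measurable lborel" by measurable
    qed
    also have "\<dots> \<le> (\<Sum>F | F facet_of P. ennreal (2 / cF F / c) * (\<integral>\<^sup>+z. g z \<partial>\<sigma>))"
    proof (rule sum_mono)
      fix F assume "F \<in> {F. F facet_of P}"
      then have fF: "F facet_of P" by simp
      note F = F[OF fF]
      have "compact F" by (rule compact_facet_of[OF fF P(2,3)])
      have "F \<subseteq> P" using fF by (rule facet_of_imp_subset)
      have "(\<integral>\<^sup>+z. g z * indicator (?S F) z \<partial>lborel) \<le> ennreal (2 * norm e / (c * norm e)) *
          (\<integral>\<^sup>+s. g (aF F + s *\<^sub>R dF F) * indicator F (aF F + s *\<^sub>R dF F) \<partial>lborel)"
      proof (rule nn_integral_behind_segment_le[OF g B \<open>compact F\<close> _ _ e ce])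
        fix b and \<tau> :: real assume b: "b \<in> F" "0 \<le> \<tau>"
        show "g (b + \<tau> *\<^sub>R e) \<le> ennreal (exp (- (c * norm e) * \<tau>)) * g b"
        proof (cases "b + \<tau> *\<^sub>R e \<in> P")
          case True
          then show ?thesis
            using reg_gap_decay[OF q(2,3) b(2) _ True] b \<open>F \<subseteq> P\<close> by (auto simp: g_def)
        qed (simp add: g_def)
      qed (use F in auto)
      \<comment> \<open>The factor \<open>cF F\<close> is inserted to turn the arc length integral
        into an integral against \<open>\<sigma>\<close>.\<close>
      also have "2 * norm e / (c * norm e) = 2 / cF F / c * cF F" using e F by simp
      also have "ennreal (2 / cF F / c * cF F) * (\<integral>\<^sup>+s. g (aF F + s *\<^sub>R dF F) * indicator F (aF F + s *\<^sub>R dF F) \<partial>lborel) =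
          ennreal (2 / cF F / c) * (\<integral>\<^sup>+z. g z * indicator F z \<partial>\<sigma>)"
        using F c nn_integral_indicator_along_line[OF g borel_compact[OF \<open>compact F\<close>] P(8), of "cF F" "aF F" "dF F"]
        by (subst ennreal_mult) (simp_all add: mult.assoc)
      also have "\<dots> \<le> ennreal (2 / cF F / c) * (\<integral>\<^sup>+z. g z \<partial>\<sigma>)"
        by (intro mult_left_mono nn_integral_mono) (auto split: split_indicator)
      finally show "(\<integral>\<^sup>+z. g z * indicator (?S F) z \<partial>lborel) \<le> ennreal (2 / cF F / c) * (\<integral>\<^sup>+z. g z \<partial>\<sigma>)" .
    qed
    also have "\<dots> = ennreal (\<Sum>F | F facet_of P. 2 / cF F / c) * (\<integral>\<^sup>+z. g z \<partial>\<sigma>)"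
      using F c by (subst sum_ennreal[symmetric]) (auto simp: sum_distrib_right intro: less_imp_le)
    also have "\<dots> \<le> ennreal (C / c) * (\<integral>\<^sup>+z. g z \<partial>\<sigma>)"
    proof (intro mult_right_mono ennreal_leI)
      show "(\<Sum>F | F facet_of P. 2 / cF F / c) \<le> C / c"
        unfolding sum_divide_distrib[symmetric] using c by (intro divide_right_mono) (auto simp: C_def)
    qed simp
    finally show "(\<integral>\<^sup>+z\<in>P. reg_gap P e (c * norm e) q z \<partial>lborel) \<le>
       ennreal (C / c) * (\<integral>\<^sup>+z\<in>P. reg_gap P e (c * norm e) q z \<partial>\<sigma>)"
      unfolding g_def .
  qed
qed

subsection \<open>Lipschitz regularity\<close>

lemma AE_lborel_not_in_open_empty:
  fixes U :: "'a::euclidean_space set"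
  assumes "open U" "AE z in lborel. z \<notin> U"
  shows "U = {}"
proof (rule ccontr)
  assume "U \<noteq> {}"
  have "U \<in> null_sets lborel"
    using assms by (subst AE_iff_null_sets) auto
  then have "negligible U"
    using assms(1) by (simp add: negligible_iff_null_sets null_sets_completion_iff)
  then show False using open_not_negligible[OF assms(1) \<open>U \<noteq> {}\<close>] by blast
qed

text \<open>The sublevel sets at integer levels are closed and convex and cover almost all of
  \<open>P\<close>. A convex set with empty interior is null, so if none of them had interior
  points, the interior of \<open>P\<close> would be null.\<close>

lemma AE_finite_convex_bounded_on_ball:
  fixes P :: "'a::euclidean_space set"
  assumes "compact P" "convex P" "interior P \<noteq> {}" "lsc_on P q" "econvex_on P q"
    "AE z in lborel. z \<in> P \<longrightarrow> q z \<noteq> \<infinity>"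
  obtains x r B where "0 < r" "ball x r \<subseteq> P" "\<And>z. z \<in> ball x r \<Longrightarrow> q z \<le> ereal B"
proof -
  define A where "A n = {x\<in>P. q x \<le> ereal (real n)}" for n
  have cl: "closed (A n)" for n
    unfolding A_def using assms(1,4) by (intro closed_sublevel compact_imp_closed)
  have cv: "convex (A n)" for n
    unfolding convex_alt
  proof (intro ballI allI impI)
    fix x y and t :: real assume xy: "x \<in> A n" "y \<in> A n" and t: "0 \<le> t \<and> t \<le> 1"
    have "q ((1 - t) *\<^sub>R x + t *\<^sub>R y) \<le> ereal (1 - t) * q x + ereal t * q y"
      using assms(5) xy t unfolding econvex_on_def A_def by auto
    also have "\<dots> \<le> ereal (1 - t) * ereal (real n) + ereal t * ereal (real n)"
      using xy t by (intro add_mono ereal_mult_left_mono) (auto simp: A_def)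
    also have "\<dots> = ereal (real n)" by (simp add: algebra_simps)
    finally show "(1 - t) *\<^sub>R x + t *\<^sub>R y \<in> A n"
      using assms(2) xy t by (auto simp: A_def convex_alt)
  qed
  have "\<exists>n. interior (A n) \<noteq> {}"
  proof (rule ccontr)
    assume "\<not> (\<exists>n. interior (A n) \<noteq> {})"
    then have "negligible (A n)" for n using negligible_convex_interior[OF cv] by blast
    then have "A n \<in> null_sets lborel" for n
      using cl by (simp add: negligible_iff_null_sets null_sets_completion_iff)
    then have "AE z in lborel. \<forall>n. z \<notin> A n" by (simp add: AE_all_countable AE_not_in)
    with assms(6) have "AE z in lborel. z \<notin> interior P"
    proof eventually_elim
      fix z assume z: "z \<in> P \<longrightarrow> q z \<noteq> \<infinity>" "\<forall>n. z \<notin> A n"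
      show "z \<notin> interior P"
      proof
        assume "z \<in> interior P"
        then have "z \<in> P" using interior_subset by blast
        then obtain n where "q z < ereal (real n)" using z(1) less_PInf_Ex_of_nat by auto
        then show False using z(2) \<open>z \<in> P\<close> by (auto simp: A_def intro: less_imp_le)
      qed
    qed
    then show False using AE_lborel_not_in_open_empty[OF open_interior] assms(3) by blast
  qed
  then obtain n x where "x \<in> interior (A n)" by blast
  then obtain r where "0 < r" "ball x r \<subseteq> A n" using mem_interior by blast
  then show thesis by (intro that[of r x "real n"]) (auto simp: A_def)
qed

text \<open>The slope bound holds for each fixed \<open>e\<close> only almost everywhere, whereas a
  Lipschitz estimate concerns all pairs. The target \<open>y\<close> is moved slightly towards
  \<open>x0\<close>, to a point around which \<open>q\<close> has an upper bound in terms of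
  \<open>q y\<close> and \<open>B\<close>. The bound is then used at points near \<open>x\<close>,
  lower semicontinuity carries it to \<open>x\<close>, and finally the displacement \<open>t\<close>
  tends to 0.\<close>

lemma lipschitz_if_AE_slope_bound:
  fixes P :: "'a::euclidean_space set"
  assumes P: "compact P" "convex P" "interior P \<noteq> {}"
    and q: "lsc_on P q" "econvex_on P q" "\<And>x. x \<in> P \<Longrightarrow> q x \<noteq> -\<infinity>"
    and fin: "AE z in lborel. z \<in> P \<longrightarrow> q z \<noteq> \<infinity>"
    and "0 \<le> c"
    and slope: "\<And>e. e \<noteq> 0 \<Longrightarrow> AE z in lborel. z \<in> P \<longrightarrow> z + e \<in> P \<longrightarrow> q z \<le> q (z + e) + ereal (c * norm e)"
  obtains f where "c-lipschitz_on P f" "\<And>x. x \<in> P \<Longrightarrow> q x = ereal (f x)"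
proof -
  obtain x0 r B where r: "0 < r" "ball x0 r \<subseteq> P" and B: "\<And>z. z \<in> ball x0 r \<Longrightarrow> q z \<le> ereal B"
    by (rule AE_finite_convex_bounded_on_ball[OF P q(1,2) fin]) blast
  have le: "q x \<le> ereal (1 - t) * q y + ereal (t * B) + ereal (c * norm ((1 - t) *\<^sub>R y + t *\<^sub>R x0 - x))"
    if x: "x \<in> P" and y: "y \<in> P" and t: "0 < t" "t \<le> 1" for x y t
  proof -
    define yt where "yt = (1 - t) *\<^sub>R y + t *\<^sub>R x0"
    define e where "e = yt - x"
    \<comment> \<open>The ball around \<open>yt\<close> is the image of \<open>ball x0 r\<close>
      under the homothety with centre \<open>y\<close> and ratio \<open>t\<close>, so convexity of
      \<open>q\<close> bounds it there.\<close>
    have near: "z \<in> P \<and> q z \<le> ereal (1 - t) * q y + ereal (t * B)" if "z \<in> ball yt (t * r)" for z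
    proof -
      define x' where "x' = x0 + (1 / t) *\<^sub>R (z - yt)"
      have "norm ((1 / t) *\<^sub>R (z - yt)) = norm (z - yt) / t" using t by simp
      also have "\<dots> < r" using that t by (simp add: dist_norm norm_minus_commute field_simps)
      finally have x': "x' \<in> ball x0 r" unfolding x'_def by (simp add: dist_norm)
      have "z = (1 - t) *\<^sub>R y + t *\<^sub>R x'" using t by (simp add: x'_def yt_def algebra_simps)
      moreover have "x' \<in> P" using x' r(2) by blast
      moreover have "(1 - t) *\<^sub>R y + t *\<^sub>R x' \<in> P"
        using P(2) y \<open>x' \<in> P\<close> t unfolding convex_alt by simp
      moreover have "q ((1 - t) *\<^sub>R y + t *\<^sub>R x') \<le> ereal (1 - t) * q y + ereal t * q x'"
        using q(2) y \<open>x' \<in> P\<close> t unfolding econvex_on_def by simp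
      moreover have "ereal t * q x' \<le> ereal (t * B)"
        using ereal_mult_left_mono[OF B[OF x'], of "ereal t"] t by simp
      ultimately show ?thesis by (auto intro: order_trans add_left_mono)
    qed
    let ?R = "ereal (1 - t) * q y + ereal (t * B) + ereal (c * norm e)"
    have "q x \<le> ?R"
    proof (rule ccontr)
      assume "\<not> q x \<le> ?R"
      then have less: "?R < q x" by simp
      show False
      proof (cases "e = 0")
        case True
        then have "?R < q x" "q x \<le> ?R" using near[of x] t r(1) less by (simp_all add: e_def zero_ereal_def[symmetric])
        then show False by (metis leD)
      next
        case False
        obtain S where S: "open S" "x \<in> S" "\<And>z. z \<in> S \<inter> P \<Longrightarrow> ?R < q z"
          using q(1)[unfolded lsc_on_iff_nhds, rule_format, OF x less] by auto
        \<comment> \<open>The slope bound fails at every point of \<open>?U\<close>, so this open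
          set is null and therefore empty. This contradicts that \<open>x\<close> lies in the
          closure of \<open>interior P\<close>.\<close>
        let ?U = "S \<inter> ball x (t * r) \<inter> interior P"
        have "AE z in lborel. z \<notin> ?U"
          using slope[OF False]
        proof eventually_elim
          fix z assume z: "z \<in> P \<longrightarrow> z + e \<in> P \<longrightarrow> q z \<le> q (z + e) + ereal (c * norm e)"
          show "z \<notin> ?U"
          proof
            assume U: "z \<in> ?U"
            then have "z \<in> P" using interior_subset by blast
            have "z + e \<in> ball yt (t * r)" using U by (simp add: e_def dist_norm algebra_simps)
            note ze = near[OF this]
            then have "q z \<le> q (z + e) + ereal (c * norm e)" using z \<open>z \<in> P\<close> by blast
            also have "\<dots> \<le> ?R" using ze by (intro add_right_mono) blast
            finally show False using S(3)[of z] U \<open>z \<in> P\<close> by auto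
          qed
        qed
        then have "?U = {}" using S(1) by (intro AE_lborel_not_in_open_empty) auto
        moreover have "x \<in> closure (interior P)"
          using x convex_closure_interior[OF P(2,3)] closure_subset by blast
        ultimately show False
          using S(2) t r(1) open_Int_closure_eq_empty[OF open_Int[OF S(1) open_ball[of x "t * r"]], of "interior P"]
          by (metis Int_iff centre_in_ball emptyE mult_pos_pos)
      qed
    qed
    then show ?thesis unfolding e_def yt_def .
  qed
  define f where "f x = real_of_ereal (q x)" for x
  have f: "q x = ereal (f x)" if "x \<in> P" for x
  proof -
    \<comment> \<open>Taking \<open>t = 1\<close> gives the weight 0 to the value at
      \<open>y\<close>, so finiteness of \<open>q\<close> on all of \<open>P\<close> follows from
      the bound \<open>B\<close> alone.\<close>
    have "x0 \<in> P" using r by auto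
    then have "q x \<le> ereal (1 - 1) * q x0 + ereal (1 * B) + ereal (c * norm ((1 - 1) *\<^sub>R x0 + 1 *\<^sub>R x0 - x))"
      by (intro le that) auto
    also have "\<dots> < \<infinity>" by (simp add: zero_ereal_def[symmetric])
    finally show ?thesis using q(3)[OF that] unfolding f_def by (cases "q x") auto
  qed
  have f_le: "f x \<le> f y + c * norm (y - x)" if "x \<in> P" "y \<in> P" for x y
  proof (rule tendsto_lowerbound)
    show "((\<lambda>t. (1 - t) * f y + t * B + c * norm ((1 - t) *\<^sub>R y + t *\<^sub>R x0 - x)) \<longlongrightarrow> f y + c * norm (y - x)) (at_right 0)"
      by (auto intro!: tendsto_eq_intros)
    have "eventually (\<lambda>t::real. 0 < t \<and> t < 1) (at_right 0)"
      using eventually_at_right_real[of 0 1] by (auto elim: eventually_mono)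
    then show "\<forall>\<^sub>F t in at_right 0. f x \<le> (1 - t) * f y + t * B + c * norm ((1 - t) *\<^sub>R y + t *\<^sub>R x0 - x)"
    proof eventually_elim
      case (elim t)
      then show ?case using le[OF that, of t] f that by simp
    qed
  qed simp
  show thesis
  proof (rule that)
    show "c-lipschitz_on P f"
    proof (rule lipschitz_onI)
      fix x y assume "x \<in> P" "y \<in> P"
      then show "dist (f x) (f y) \<le> c * dist x y"
        using f_le[of x y] f_le[of y x] by (simp add: dist_norm norm_minus_commute abs_le_iff)
    qed fact
  qed (rule f)
qed

text \<open>Here \<open>A\<close> and \<open>I\<close> stand for the boundary and interior integrals
  of the regularised exponential, \<open>a\<close> and \<open>i\<close> for those of the gap. The
  comparison of ratios says \<open>a * I \<le> A * i\<close>. With \<open>i \<le> K * a\<close> and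
  \<open>a > 0\<close> this gives \<open>I \<le> K * A\<close>, hence
  \<open>I + i \<le> K * (A + a)\<close>, against the last hypothesis.\<close>

lemma ennreal_ratio_gap_eq_0:
  fixes A a I i :: ennreal
  assumes fin: "A + a < \<infinity>" "I + i < \<infinity>" and pos: "0 < I"
    and min: "(A + a) / (I + i) \<le> A / I"
    and gap: "i \<le> ennreal K * a" and "0 \<le> K" and K: "K * enn2real (A + a) < enn2real (I + i)"
  shows "i = 0"
proof -
  obtain A' a' I' i' where r: "A = ennreal A'" "a = ennreal a'" "I = ennreal I'" "i = ennreal i'"
    "0 \<le> A'" "0 \<le> a'" "0 \<le> I'" "0 \<le> i'"
    using fin by (cases A; cases a; cases I; cases i) auto
  have "0 < I'" using pos r by simp
  have "(A' + a') / (I' + i') \<le> A' / I'"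
    using min r \<open>0 < I'\<close> by (simp add: divide_ennreal flip: ennreal_plus)
  then have *: "a' * I' \<le> A' * i'" using \<open>0 < I'\<close> r by (simp add: field_simps)
  have i: "i' \<le> K * a'" using gap r \<open>0 \<le> K\<close> by (simp flip: ennreal_mult)
  have K': "K * (A' + a') < I' + i'" using K r by (simp flip: ennreal_plus)
  have "i' = 0"
  proof (rule ccontr)
    assume "i' \<noteq> 0"
    then have "0 < i'" using r by simp
    then have "0 < a'" using i r(6) \<open>0 \<le> K\<close> by (cases "a' = 0") auto
    have "a' * I' \<le> A' * (K * a')" using * i r(5) by (meson mult_left_mono order_trans)
    then have "I' \<le> K * A'" using \<open>0 < a'\<close> by (simp add: mult_ac)
    then show False using K' i by (simp add: algebra_simps)
  qed
  then show ?thesis using r by simp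
qed

section \<open>Finiteness and measurability for the two measures of a system\<close>

lemma system2_nn_integral_mu:
  fixes P :: "'a::euclidean_space set"
  assumes "system2 P \<mu> \<sigma>"
  obtains c where "c > 0" "\<And>f. (\<lambda>x. f x * indicator P x) \<in> borel_measurable borel \<Longrightarrow>
    (\<integral>\<^sup>+x\<in>P. f x \<partial>\<mu>) = ennreal c * (\<integral>\<^sup>+x\<in>P. f x \<partial>lborel)"
proof -
  note P = system2D[OF assms]
  obtain c where c: "c > 0" "\<mu> = density lborel (\<lambda>x. ennreal c * indicator P x)"
    using assms unfolding system2_def by blast
  note [measurable] = P(5)
  show thesis
  proof (rule that[OF c(1)])
    fix f :: "'a \<Rightarrow> ennreal" assume f [measurable]: "(\<lambda>x. f x * indicator P x) \<in> borel_measurable borel"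
    have "(\<integral>\<^sup>+x\<in>P. f x \<partial>\<mu>) = (\<integral>\<^sup>+x. ennreal c * indicator P x * (f x * indicator P x) \<partial>lborel)"
      unfolding c(2) by (rule nn_integral_density) measurable
    also have "\<dots> = (\<integral>\<^sup>+x. ennreal c * (f x * indicator P x) \<partial>lborel)"
      by (rule nn_integral_cong) (auto split: split_indicator)
    also have "\<dots> = ennreal c * (\<integral>\<^sup>+x\<in>P. f x \<partial>lborel)"
      by (rule nn_integral_cmult) measurable
    finally show "(\<integral>\<^sup>+x\<in>P. f x \<partial>\<mu>) = ennreal c * (\<integral>\<^sup>+x\<in>P. f x \<partial>lborel)" .
  qed
qed

lemma system2_sets_mu: "system2 P \<mu> \<sigma> \<Longrightarrow> sets \<mu> = sets borel"
  unfolding system2_def by (elim conjE exE) simp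

text \<open>The frontier consists of finitely many facets, each bounded and hence of finite length,
  and \<open>\<sigma>\<close> does not charge the rest of the plane.\<close>

lemma
  fixes P :: "'a::euclidean_space set"
  assumes sys: "system2 P \<mu> \<sigma>"
  shows emeasure_sigma_less_top: "emeasure \<sigma> P < \<infinity>" and AE_sigma_in_polytope: "AE x in \<sigma>. x \<in> P"
proof -
  note P = system2D[OF sys]
  have fr: "emeasure \<sigma> (- frontier P) = 0" using sys unfolding system2_def by blast
  have fin: "emeasure \<sigma> F < \<infinity>" if F: "F facet_of P" for F
  proof -
    obtain c a d where c: "norm d = 1" "\<And>A. A \<in> sets borel \<Longrightarrow> emeasure \<sigma> (A \<inter> F) =
               ennreal c * emeasure lborel ((\<lambda>t::real. a + t *\<^sub>R d) -` (A \<inter> F))"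
      using sys F unfolding system2_def by blast
    have "bounded F" by (rule compact_imp_bounded[OF compact_facet_of[OF F P(2,3)]])
    then obtain M where M: "\<And>x. x \<in> F \<Longrightarrow> norm x \<le> M" unfolding bounded_iff by blast
    have "\<bar>t\<bar> \<le> M + norm a" if "a + t *\<^sub>R d \<in> F" for t
      using M[OF that] norm_triangle_ineq4[of "a + t *\<^sub>R d" a] c(1) by simp
    then have "bounded ((\<lambda>t::real. a + t *\<^sub>R d) -` (UNIV \<inter> F))"
      unfolding bounded_iff by (auto intro!: exI[of _ "M + norm a"])
    then have "emeasure lborel ((\<lambda>t::real. a + t *\<^sub>R d) -` (UNIV \<inter> F)) < \<infinity>"
      by (rule emeasure_bounded_finite)
    then show ?thesis using c(2)[of UNIV] by (simp add: ennreal_mult_less_top)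
  qed
  have sub: "frontier P \<subseteq> P" using P(4) by (rule frontier_subset_closed)
  show "AE x in \<sigma>. x \<in> P"
  proof (rule AE_I)
    show "{x \<in> space \<sigma>. x \<notin> P} \<subseteq> - frontier P" using sub by auto
    show "- frontier P \<in> sets \<sigma>" unfolding P(8) by simp
  qed (rule fr)
  have "emeasure \<sigma> P \<le> emeasure \<sigma> (frontier P \<union> - frontier P)"
    using P(8) by (intro emeasure_mono) auto
  also have "\<dots> \<le> emeasure \<sigma> (frontier P) + emeasure \<sigma> (- frontier P)"
    by (rule emeasure_subadditive) (simp_all add: P(8))
  also have "\<dots> = emeasure \<sigma> (\<Union>F\<in>{F. F facet_of P}. F)"
    using fr P(10) by simp
  also have "\<dots> \<le> (\<Sum>F\<in>{F. F facet_of P}. emeasure \<sigma> F)"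
  proof (rule emeasure_subadditive_finite[OF P(9)])
    show "(\<lambda>F. F) ` {F. F facet_of P} \<subseteq> sets \<sigma>"
      using P(8) compact_facet_of[OF _ P(2,3)] by (auto simp: borel_compact)
  qed
  also have "\<dots> < \<infinity>" using fin P(9) by simp
  finally show "emeasure \<sigma> P < \<infinity>" .
qed

lemma borel_measurable_eexp_lsc_on:
  fixes P :: "'a::euclidean_space set"
  assumes "closed P" "lsc_on P q"
  shows "(\<lambda>z. eexp (q z) * indicator P z) \<in> borel_measurable borel"
proof -
  note [measurable] = borel_measurable_lsc_on[OF assms]
  have [measurable]: "P \<in> sets borel" using assms(1) by simp
  have "(\<lambda>z. eexp (q z) * indicator P z) = (\<lambda>z. eexp (if z \<in> P then q z else \<infinity>) * indicator P z)"
    by (auto simp: fun_eq_iff)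
  then show ?thesis by (simp only:) measurable
qed

subsection \<open>Minimisers\<close>

text \<open>Members of \<open>E1\<close> and \<open>M1\<close> are unconstrained off
  \<open>P\<close>. Cutting the boundary integral to \<open>P\<close> gives integrands whose
  measurability follows from lower semicontinuity.\<close>

lemma nn_integral_sigma_restrict:
  fixes P :: "'a::euclidean_space set"
  assumes "system2 P \<mu> \<sigma>"
  shows "(\<integral>\<^sup>+x. f x \<partial>\<sigma>) = (\<integral>\<^sup>+x\<in>P. f x \<partial>\<sigma>)"
proof (rule nn_integral_cong_AE)
  show "AE x in \<sigma>. f x = f x * indicator P x"
    using AE_sigma_in_polytope[OF assms] by eventually_elim simp
qed

lemma emeasure_lborel_compact_interior:
  fixes P :: "'a::euclidean_space set"
  assumes "compact P" "interior P \<noteq> {}"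
  shows "0 < emeasure lborel P" "emeasure lborel P < \<infinity>"
proof -
  have "emeasure lborel P \<noteq> 0"
  proof
    assume "emeasure lborel P = 0"
    then have "P \<in> null_sets lborel" using assms(1) by (simp add: null_sets_def borel_compact)
    then have "AE z in lborel. z \<notin> interior P"
      using interior_subset by (blast intro: eventually_mono[OF AE_not_in])
    then show False using AE_lborel_not_in_open_empty[OF open_interior] assms(2) by blast
  qed
  then show "0 < emeasure lborel P" by (simp add: zero_less_iff_neq_zero)
qed (rule emeasure_compact_finite[OF assms(1)])

lemma nn_integral_eexp_pos:
  fixes P :: "'a::euclidean_space set"
  assumes sys: "system2 P \<mu> \<sigma>" and q: "lsc_on P q" "\<And>x. x \<in> P \<Longrightarrow> q x \<noteq> -\<infinity>"
  shows "0 < (\<integral>\<^sup>+x\<in>P. eexp (q x) \<partial>\<mu>)"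
proof -
  note P = system2D[OF sys]
  obtain c where c: "c > 0" "\<And>f. (\<lambda>x. f x * indicator P x) \<in> borel_measurable borel \<Longrightarrow>
    (\<integral>\<^sup>+x\<in>P. f x \<partial>\<mu>) = ennreal c * (\<integral>\<^sup>+x\<in>P. f x \<partial>lborel)"
    by (rule system2_nn_integral_mu[OF sys]) blast
  note meas = borel_measurable_eexp_lsc_on[OF P(4) q(1)]
  have "(\<integral>\<^sup>+x\<in>P. eexp (q x) \<partial>lborel) \<noteq> 0"
  proof
    assume "(\<integral>\<^sup>+x\<in>P. eexp (q x) \<partial>lborel) = 0"
    then have "AE x in lborel. eexp (q x) * indicator P x = 0"
      using meas by (subst (asm) nn_integral_0_iff_AE) auto
    then have "AE x in lborel. x \<notin> interior P"
    proof eventually_elim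
      fix x assume "eexp (q x) * indicator P x = 0"
      then have "x \<notin> P" using q(2)[of x] by (auto simp: eexp_eq_0_iff)
      then show "x \<notin> interior P" using interior_subset by blast
    qed
    then show False using AE_lborel_not_in_open_empty[OF open_interior] P(6) by blast
  qed
  then show ?thesis using c(1) c(2)[OF meas] by (simp add: ennreal_zero_less_mult_iff zero_less_iff_neq_zero)
qed

text \<open>The constant 0 serves as a competitor of finite ratio.\<close>

lemma
  fixes P :: "'a::euclidean_space set"
  assumes sys: "system2 P \<mu> \<sigma>"
  shows zero_in_E1: "(\<lambda>_. 0) \<in> E1 P \<mu>"
    and NA_ratio_zero_less_top: "NA_ratio P \<mu> \<sigma> (\<lambda>_. 0) < \<infinity>"
    and emeasure_mu_less_top: "emeasure \<mu> P < \<infinity>"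
    and emeasure_mu_pos: "0 < emeasure \<mu> P"
proof -
  note P = system2D[OF sys]
  have eexp0: "eexp 0 = 1" by (simp add: eexp_def)
  have sets: "sets \<mu> = sets borel" by (rule system2_sets_mu[OF sys])
  obtain c where c: "c > 0" "\<And>f. (\<lambda>x. f x * indicator P x) \<in> borel_measurable borel \<Longrightarrow>
    (\<integral>\<^sup>+x\<in>P. f x \<partial>\<mu>) = ennreal c * (\<integral>\<^sup>+x\<in>P. f x \<partial>lborel)"
    by (rule system2_nn_integral_mu[OF sys]) blast
  have "(\<integral>\<^sup>+x\<in>P. 1 \<partial>\<mu>) = ennreal c * (\<integral>\<^sup>+x\<in>P. 1 \<partial>lborel)"
    using P(5) by (intro c(2)) simp
  then have eq: "emeasure \<mu> P = ennreal c * emeasure lborel P"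
    using P(5) sets by simp
  show fin: "emeasure \<mu> P < \<infinity>" and pos: "0 < emeasure \<mu> P"
    unfolding eq using emeasure_lborel_compact_interior[OF P(2,6)] c(1)
    by (simp_all add: ennreal_mult_less_top ennreal_zero_less_mult_iff)
  show "(\<lambda>_. 0) \<in> E1 P \<mu>"
    using fin P(5) sets unfolding E1_def lsc_on_iff_nhds econvex_on_def by (auto simp: eexp0)
  have "NA_ratio P \<mu> \<sigma> (\<lambda>_. 0) = (\<integral>\<^sup>+x\<in>P. 1 \<partial>\<sigma>) / (\<integral>\<^sup>+x\<in>P. 1 \<partial>\<mu>)"
    unfolding NA_ratio_def eexp0 by (subst nn_integral_sigma_restrict[OF sys]) (rule refl)
  also have "\<dots> = emeasure \<sigma> P / emeasure \<mu> P"
    using P(5,8) sets by simp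
  finally have "NA_ratio P \<mu> \<sigma> (\<lambda>_. 0) = emeasure \<sigma> P / emeasure \<mu> P" .
  then show "NA_ratio P \<mu> \<sigma> (\<lambda>_. 0) < \<infinity>"
    using emeasure_sigma_less_top[OF sys] pos by (auto simp: ennreal_divide_eq_top_iff less_top[symmetric])
qed

text \<open>The regularisation is itself a competitor. It removes the gap from both integrals, and
  for large \<open>c\<close> the interior share is so small a fraction of the boundary share that a
  positive gap would lower the ratio.\<close>

lemma AE_reg_gap_minimizer_eq_0:
  fixes P :: "'a::euclidean_space set"
  assumes sys: "system2 P \<mu> \<sigma>" and q: "q \<in> E1 P \<mu>"
    and min: "\<And>q'. q' \<in> E1 P \<mu> \<Longrightarrow> NA_ratio P \<mu> \<sigma> q \<le> NA_ratio P \<mu> \<sigma> q'"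
  obtains c where "c > 0" "\<And>e. e \<noteq> 0 \<Longrightarrow> AE z in lborel. z \<in> P \<longrightarrow> reg_gap P e (c * norm e) q z = 0"
proof -
  note P = system2D[OF sys]
  have sets: "sets \<mu> = sets borel" by (rule system2_sets_mu[OF sys])
  obtain c0 where c0: "c0 > 0" "\<And>f. (\<lambda>x. f x * indicator P x) \<in> borel_measurable borel \<Longrightarrow>
    (\<integral>\<^sup>+x\<in>P. f x \<partial>\<mu>) = ennreal c0 * (\<integral>\<^sup>+x\<in>P. f x \<partial>lborel)"
    by (rule system2_nn_integral_mu[OF sys]) blast
  obtain C where C: "C > 0" "\<And>q e c. lsc_on P q \<Longrightarrow> econvex_on P q \<Longrightarrow> (\<And>x. x \<in> P \<Longrightarrow> q x \<noteq> -\<infinity>) \<Longrightarrow>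
     e \<noteq> 0 \<Longrightarrow> c > 0 \<Longrightarrow>
     (\<integral>\<^sup>+z\<in>P. reg_gap P e (c * norm e) q z \<partial>lborel) \<le>
       ennreal (C / c) * (\<integral>\<^sup>+z\<in>P. reg_gap P e (c * norm e) q z \<partial>\<sigma>)"
    by (rule nn_integral_reg_gap_le[OF sys]) blast
  have q': "lsc_on P q" "econvex_on P q" "\<And>x. x \<in> P \<Longrightarrow> q x \<noteq> -\<infinity>" "(\<integral>\<^sup>+x\<in>P. eexp (q x) \<partial>\<mu>) < \<infinity>"
    using q unfolding E1_def by auto
  define A where "A q = (\<integral>\<^sup>+x\<in>P. eexp (q x) \<partial>\<sigma>)" for q
  define I where "I q = (\<integral>\<^sup>+x\<in>P. eexp (q x) \<partial>\<mu>)" for q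
  have NA: "NA_ratio P \<mu> \<sigma> q = A q / I q" for q
    unfolding NA_ratio_def A_def I_def by (subst nn_integral_sigma_restrict[OF sys]) (rule refl)
  have Ipos: "0 < I q" unfolding I_def by (rule nn_integral_eexp_pos[OF sys q'(1,3)])
  have Ifin: "I q < \<infinity>" using q'(4) by (simp add: I_def)
  \<comment> \<open>Membership in \<open>E1\<close> bounds only the interior integral; the boundary
    integral of a minimiser is finite because its ratio is at most that of the constant 0.\<close>
  have "A q / I q < \<infinity>"
    using min[OF zero_in_E1[OF sys]] NA_ratio_zero_less_top[OF sys] unfolding NA by (rule le_less_trans)
  then have Afin: "A q < \<infinity>" using Ifin by (auto simp: ennreal_top_divide less_top[symmetric])
  define Ar where "Ar = enn2real (A q)"
  define Ir where "Ir = enn2real (I q)"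
  have Ir: "0 < Ir" and Ar: "0 \<le> Ar" using Ipos Ifin by (simp_all add: Ir_def Ar_def enn2real_positive_iff)
  \<comment> \<open>Chosen so that \<open>c0 * C / c * Ar < Ir\<close>, the smallness condition of
    \<open>ennreal_ratio_gap_eq_0\<close> for \<open>K = c0 * C / c\<close>; the summand 1 makes it
    strict. The value depends on \<open>q\<close> but not on \<open>e\<close>.\<close>
  define c where "c = c0 * C * Ar / Ir + 1"
  have c: "c > 0" unfolding c_def using Ar Ir C(1) c0(1) by (intro add_nonneg_pos) auto
  have K: "c0 * C / c * Ar < Ir"
  proof -
    have "c0 * C * Ar < Ir * c" unfolding c_def using Ir by (simp add: field_simps)
    then show ?thesis using c by (simp add: field_simps)
  qed
  show thesis
  proof (rule that[OF c])
    fix e :: 'a assume e: "e \<noteq> 0"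
    let ?r = "slope_reg P e (c * norm e) q" and ?w = "reg_gap P e (c * norm e) q"
    have ce: "0 \<le> c * norm e" using c by simp
    have wm: "(\<lambda>z. ?w z * indicator P z) \<in> borel_measurable borel"
      by (rule borel_measurable_reg_gap[OF P(2) q'(1) e])
    have r1: "lsc_on P ?r" by (rule lsc_on_slope_reg[OF P(2) q'(1) e])
    have r2: "econvex_on P ?r" by (rule econvex_on_slope_reg[OF P(2,3) q'(1,2) e ce q'(3)])
    obtain m where "\<And>x. x \<in> P \<Longrightarrow> ereal m \<le> q x"
      by (rule lsc_on_compact_bounded_below[OF P(2) q'(1,3)]) blast+
    then have r3: "?r x \<noteq> -\<infinity>" for x
      using slope_reg_ge[of P m q "c * norm e" e x] ce by auto
    have rm: "(\<lambda>z. eexp (?r z) * indicator P z) \<in> borel_measurable borel"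
      by (rule borel_measurable_eexp_lsc_on[OF P(4) r1])
    \<comment> \<open>Stated for an arbitrary Borel measure, as it is applied to
      \<open>\<mu>\<close> and to \<open>\<sigma>\<close>.\<close>
    have split: "(\<integral>\<^sup>+x\<in>P. eexp (q x) \<partial>M) = (\<integral>\<^sup>+x\<in>P. eexp (?r x) \<partial>M) + (\<integral>\<^sup>+x\<in>P. ?w x \<partial>M)"
      if M: "sets M = sets borel" for M
    proof -
      have "(\<integral>\<^sup>+x\<in>P. eexp (q x) \<partial>M) = (\<integral>\<^sup>+x. eexp (?r x) * indicator P x + ?w x * indicator P x \<partial>M)"
        by (rule nn_integral_cong) (auto simp: eexp_slope_reg_add_gap split: split_indicator)
      also have "\<dots> = (\<integral>\<^sup>+x\<in>P. eexp (?r x) \<partial>M) + (\<integral>\<^sup>+x\<in>P. ?w x \<partial>M)"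
        using rm wm by (intro nn_integral_add) (simp_all cong: measurable_cong_sets[OF M refl])
      finally show ?thesis .
    qed
    have Iq: "I q = I ?r + (\<integral>\<^sup>+x\<in>P. ?w x \<partial>\<mu>)" unfolding I_def by (rule split[OF sets])
    have Aq: "A q = A ?r + (\<integral>\<^sup>+x\<in>P. ?w x \<partial>\<sigma>)" unfolding A_def by (rule split[OF P(8)])
    have "I ?r < \<infinity>" using Ifin unfolding Iq by simp
    then have "?r \<in> E1 P \<mu>" using r1 r2 r3 unfolding E1_def I_def by simp
    then have "A q / I q \<le> A ?r / I ?r" using min unfolding NA by blast
    have "(\<integral>\<^sup>+x\<in>P. ?w x \<partial>\<mu>) = 0"
    proof (rule ennreal_ratio_gap_eq_0)
      show "A ?r + (\<integral>\<^sup>+x\<in>P. ?w x \<partial>\<sigma>) < \<infinity>" using Afin unfolding Aq .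
      show "I ?r + (\<integral>\<^sup>+x\<in>P. ?w x \<partial>\<mu>) < \<infinity>" using Ifin unfolding Iq .
      show "0 < I ?r" unfolding I_def by (rule nn_integral_eexp_pos[OF sys r1 r3])
      show "(A ?r + (\<integral>\<^sup>+x\<in>P. ?w x \<partial>\<sigma>)) / (I ?r + (\<integral>\<^sup>+x\<in>P. ?w x \<partial>\<mu>)) \<le> A ?r / I ?r"
        using \<open>A q / I q \<le> A ?r / I ?r\<close> unfolding Aq Iq .
      show "0 \<le> c0 * C / c" using c0(1) C(1) c by simp
      show "c0 * C / c * enn2real (A ?r + (\<integral>\<^sup>+x\<in>P. ?w x \<partial>\<sigma>)) < enn2real (I ?r + (\<integral>\<^sup>+x\<in>P. ?w x \<partial>\<mu>))"
        using K unfolding Ar_def Ir_def Aq Iq .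
      have "(\<integral>\<^sup>+x\<in>P. ?w x \<partial>\<mu>) = ennreal c0 * (\<integral>\<^sup>+x\<in>P. ?w x \<partial>lborel)" by (rule c0(2)[OF wm])
      also have "\<dots> \<le> ennreal c0 * (ennreal (C / c) * (\<integral>\<^sup>+x\<in>P. ?w x \<partial>\<sigma>))"
        by (intro mult_left_mono C(2) q' e c) auto
      also have "\<dots> = ennreal (c0 * C / c) * (\<integral>\<^sup>+x\<in>P. ?w x \<partial>\<sigma>)"
      proof -
        have "ennreal (c0 * (C / c)) = ennreal c0 * ennreal (C / c)"
          using c0(1) C(1) c by (intro ennreal_mult) auto
        then show ?thesis by (simp add: mult.assoc)
      qed
      finally show "(\<integral>\<^sup>+x\<in>P. ?w x \<partial>\<mu>) \<le> ennreal (c0 * C / c) * (\<integral>\<^sup>+x\<in>P. ?w x \<partial>\<sigma>)" .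
    qed
    then have "(\<integral>\<^sup>+x\<in>P. ?w x \<partial>lborel) = 0" using c0(2)[OF wm] c0(1) by simp
    then have "AE z in lborel. ?w z * indicator P z = 0"
      using wm by (subst (asm) nn_integral_0_iff_AE) auto
    then show "AE z in lborel. z \<in> P \<longrightarrow> ?w z = 0"
      by eventually_elim auto
  qed
qed

text \<open>A vanishing gap means that \<open>q\<close> agrees with its regularisation, which is a
  one-sided slope bound in direction \<open>e\<close>. Integrability of the exponential makes
  \<open>q\<close> finite almost everywhere, so the Lipschitz criterion applies.\<close>

lemma lipschitz_minimizer:
  fixes P :: "'a::euclidean_space set"
  assumes sys: "system2 P \<mu> \<sigma>" and q: "q \<in> E1 P \<mu>"
    and min: "\<And>q'. q' \<in> E1 P \<mu> \<Longrightarrow> NA_ratio P \<mu> \<sigma> q \<le> NA_ratio P \<mu> \<sigma> q'"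
  obtains c f where "c-lipschitz_on P f" "\<And>x. x \<in> P \<Longrightarrow> q x = ereal (f x)"
proof -
  note P = system2D[OF sys]
  have q': "lsc_on P q" "econvex_on P q" "\<And>x. x \<in> P \<Longrightarrow> q x \<noteq> -\<infinity>" "(\<integral>\<^sup>+x\<in>P. eexp (q x) \<partial>\<mu>) < \<infinity>"
    using q unfolding E1_def by auto
  obtain c where c: "c > 0" "\<And>e. e \<noteq> 0 \<Longrightarrow> AE z in lborel. z \<in> P \<longrightarrow> reg_gap P e (c * norm e) q z = 0"
    by (rule AE_reg_gap_minimizer_eq_0[OF sys q min]) blast+
  obtain c0 where c0: "c0 > 0" "\<And>f. (\<lambda>x. f x * indicator P x) \<in> borel_measurable borel \<Longrightarrow>
    (\<integral>\<^sup>+x\<in>P. f x \<partial>\<mu>) = ennreal c0 * (\<integral>\<^sup>+x\<in>P. f x \<partial>lborel)"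
    by (rule system2_nn_integral_mu[OF sys]) blast
  note meas = borel_measurable_eexp_lsc_on[OF P(4) q'(1)]
  have "ennreal c0 * (\<integral>\<^sup>+x\<in>P. eexp (q x) \<partial>lborel) < \<infinity>"
    using q'(4) unfolding c0(2)[OF meas] .
  then have "(\<integral>\<^sup>+x\<in>P. eexp (q x) \<partial>lborel) \<noteq> \<infinity>"
    using c0(1) by (auto simp: ennreal_mult_top)
  then have "AE x in lborel. eexp (q x) * indicator P x \<noteq> \<infinity>"
    using meas by (intro nn_integral_noteq_infinite) auto
  then have fin: "AE x in lborel. x \<in> P \<longrightarrow> q x \<noteq> \<infinity>"
    by eventually_elim (auto simp: eexp_def)
  have slope: "AE z in lborel. z \<in> P \<longrightarrow> z + e \<in> P \<longrightarrow> q z \<le> q (z + e) + ereal (c * norm e)" if e: "e \<noteq> 0" for e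
    using c(2)[OF e]
  proof eventually_elim
    fix z assume z: "z \<in> P \<longrightarrow> reg_gap P e (c * norm e) q z = 0"
    show "z \<in> P \<longrightarrow> z + e \<in> P \<longrightarrow> q z \<le> q (z + e) + ereal (c * norm e)"
    proof (intro impI)
      assume "z \<in> P" "z + e \<in> P"
      have "\<not> slope_reg P e (c * norm e) q z < q z"
      proof
        assume less: "slope_reg P e (c * norm e) q z < q z"
        then have "eexp (q z) - eexp (slope_reg P e (c * norm e) q z) = 0"
          using z \<open>z \<in> P\<close> by (simp add: reg_gap_def)
        then show False using eexp_strict_mono[OF less] by (auto simp: diff_eq_0_iff_ennreal)
      qed
      \<comment> \<open>Only the competitor \<open>t = 1\<close> of the infimum is used; all
        displacements are covered because \<open>e\<close> is an arbitrary nonzero vector.\<close>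
      then show "q z \<le> q (z + e) + ereal (c * norm e)"
        using slope_reg_le_shift[of 1 z e P "c * norm e" q] \<open>z + e \<in> P\<close> by (simp add: not_less)
    qed
  qed
  show thesis
    by (rule lipschitz_if_AE_slope_bound[OF P(2,3,6) q'(1-3) fin less_imp_le[OF c(1)] slope]) (blast intro: that)+
qed

text \<open>Adding a constant to \<open>q\<close> leaves the ratio unchanged, so every competitor
  can be normalised to have its exponential in \<open>M1\<close>. There the ratio coincides with
  \<open>U_fun\<close>.\<close>

lemma eln_minimizer:
  fixes P :: "'a::euclidean_space set"
  assumes sys: "system2 P \<mu> \<sigma>" and u: "u \<in> M1 P \<mu>"
    and min: "\<And>u'. u' \<in> M1 P \<mu> \<Longrightarrow> U_fun P \<mu> \<sigma> u \<le> U_fun P \<mu> \<sigma> u'"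
  shows "(\<lambda>x. eln (u x)) \<in> E1 P \<mu>"
    and "q \<in> E1 P \<mu> \<Longrightarrow> NA_ratio P \<mu> \<sigma> (\<lambda>x. eln (u x)) \<le> NA_ratio P \<mu> \<sigma> q"
proof -
  note P = system2D[OF sys]
  have sets: "sets \<mu> = sets borel" by (rule system2_sets_mu[OF sys])
  have pos: "0 < u x" if "x \<in> P" for x using u that unfolding M1_def by simp
  have eln: "eln (u x) \<noteq> -\<infinity>" if "x \<in> P" for x
    using pos[OF that] by (auto simp: eln_def)
  show "(\<lambda>x. eln (u x)) \<in> E1 P \<mu>"
    using u eln emeasure_mu_less_top[OF sys] lsc_on_eexp_iff[of P "\<lambda>x. eln (u x)"]
    unfolding E1_def M1_def by (simp add: eexp_eln)
  assume q: "q \<in> E1 P \<mu>"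
  then have q': "lsc_on P q" "econvex_on P q" "\<And>x. x \<in> P \<Longrightarrow> q x \<noteq> -\<infinity>" "(\<integral>\<^sup>+x\<in>P. eexp (q x) \<partial>\<mu>) < \<infinity>"
    unfolding E1_def by auto
  define I where "I = (\<integral>\<^sup>+x\<in>P. eexp (q x) \<partial>\<mu>)"
  have I: "0 < I" "I < \<infinity>" unfolding I_def using nn_integral_eexp_pos[OF sys q'(1,3)] q'(4) by auto
  define m where "m = emeasure \<mu> P"
  have m: "0 < m" "m < \<infinity>" unfolding m_def using emeasure_mu_less_top[OF sys] emeasure_mu_pos[OF sys] by auto
  obtain Ir mr where r: "I = ennreal Ir" "m = ennreal mr" "0 < Ir" "0 < mr"
    using I m by (cases I; cases m) auto
  \<comment> \<open>The factor that brings the interior integral of the exponential of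
    \<open>q\<close> to the total mass \<open>emeasure \<mu> P\<close>.\<close>
  define k where "k = mr / Ir"
  have k: "0 < k" "ennreal k * I = m" "ennreal k / m = 1 / I"
    using r by (simp_all add: k_def divide_ennreal flip: ennreal_mult ennreal_1)
  define v where "v x = eexp (q x + ereal (ln k))" for x
  have v: "v x = ennreal k * eexp (q x)" for x using k(1) by (simp add: v_def eexp_add)
  have lsc: "lsc_on P (\<lambda>x. q x + ereal (ln k))"
    unfolding lsc_on_def
  proof
    fix x assume "x \<in> P"
    \<comment> \<open>Pulling the constant out of the \<open>Liminf\<close> needs a nontrivial
      filter; for the trivial filter the right-hand side is \<infinity>.\<close>
    show "q x + ereal (ln k) \<le> Liminf (at x within P) (\<lambda>x. q x + ereal (ln k))"
    proof (cases "at x within P = bot")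
      case True
      then show ?thesis by simp
    next
      case False
      then show ?thesis
        using q'(1) \<open>x \<in> P\<close> unfolding lsc_on_def
        by (subst Liminf_add_ereal_right) (auto intro: add_right_mono)
    qed
  qed
  have cvx: "econvex_on P (\<lambda>x. q x + ereal (ln k))"
    unfolding econvex_on_def
  proof (intro ballI allI impI)
    fix x y and t :: real assume xy: "x \<in> P" "y \<in> P" and t: "0 \<le> t \<and> t \<le> 1"
    have "q ((1 - t) *\<^sub>R x + t *\<^sub>R y) + ereal (ln k) \<le> ereal (1 - t) * q x + ereal t * q y + ereal (ln k)"
      using q'(2) xy t unfolding econvex_on_def by (intro add_right_mono) blast
    also have "\<dots> = ereal (1 - t) * (q x + ereal (ln k)) + ereal t * (q y + ereal (ln k))"
    proof -
      have "ereal a * (z + ereal b) = ereal a * z + ereal (a * b)" if "0 \<le> a" for a b z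
        using that by (cases z) (auto simp: algebra_simps)
      then have "ereal (1 - t) * (q x + ereal (ln k)) + ereal t * (q y + ereal (ln k)) =
          (ereal (1 - t) * q x + ereal ((1 - t) * ln k)) + (ereal t * q y + ereal (t * ln k))"
        using t by simp
      also have "\<dots> = ereal (1 - t) * q x + ereal t * q y + (ereal ((1 - t) * ln k) + ereal (t * ln k))"
        by (simp only: ac_simps)
      also have "ereal ((1 - t) * ln k) + ereal (t * ln k) = ereal (ln k)" by (simp add: algebra_simps)
      finally show ?thesis by simp
    qed
    finally show "q ((1 - t) *\<^sub>R x + t *\<^sub>R y) + ereal (ln k) \<le> ereal (1 - t) * (q x + ereal (ln k)) + ereal t * (q y + ereal (ln k))" .
  qed
  have meas: "(\<lambda>x. eexp (q x) * indicator P x) \<in> borel_measurable borel"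
    by (rule borel_measurable_eexp_lsc_on[OF P(4) q'(1)])
  have int: "(\<integral>\<^sup>+x\<in>P. v x \<partial>M) = ennreal k * (\<integral>\<^sup>+x\<in>P. eexp (q x) \<partial>M)" if M: "sets M = sets borel" for M
    unfolding v mult.assoc using meas by (intro nn_integral_cmult) (simp cong: measurable_cong_sets[OF M refl])
  have "v \<in> M1 P \<mu>"
    unfolding M1_def
  proof (intro CollectI conjI ballI)
    fix x assume "x \<in> P"
    then have "eexp (q x) \<noteq> 0" using q'(3) by (simp add: eexp_eq_0_iff)
    then show "0 < v x" using k(1) by (simp add: v ennreal_zero_less_mult_iff zero_less_iff_neq_zero)
  next
    show "lsc_on P v" unfolding v_def using lsc by (simp add: lsc_on_eexp_iff)
    show "econvex_on P (\<lambda>x. eln (v x))" unfolding v_def using cvx by (simp add: eln_eexp)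
    show "(\<integral>\<^sup>+x\<in>P. v x \<partial>\<mu>) = emeasure \<mu> P" using int[OF sets] k(2) by (simp add: I_def m_def)
  qed
  then have "U_fun P \<mu> \<sigma> u \<le> U_fun P \<mu> \<sigma> v" by (rule min)
  also have "\<dots> = ennreal k * (\<integral>\<^sup>+x\<in>P. eexp (q x) \<partial>\<sigma>) / m"
    unfolding U_fun_def m_def int[OF P(8), symmetric] by (subst nn_integral_sigma_restrict[OF sys]) (rule refl)
  also have "\<dots> = (\<integral>\<^sup>+x\<in>P. eexp (q x) \<partial>\<sigma>) * (ennreal k / m)"
    by (simp add: divide_ennreal_def mult_ac)
  also have "\<dots> = NA_ratio P \<mu> \<sigma> q"
    unfolding k(3) NA_ratio_def I_def
    by (subst (2) nn_integral_sigma_restrict[OF sys]) (simp add: divide_ennreal_def)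
  \<comment> \<open>For \<open>u\<close> in \<open>M1\<close> the denominator of the ratio is
    already \<open>emeasure \<mu> P\<close>.\<close>
  also have "U_fun P \<mu> \<sigma> u = NA_ratio P \<mu> \<sigma> (\<lambda>x. eln (u x))"
    using u unfolding U_fun_def NA_ratio_def eexp_eln M1_def by simp
  finally show "NA_ratio P \<mu> \<sigma> (\<lambda>x. eln (u x)) \<le> NA_ratio P \<mu> \<sigma> q" .
qed

theorem mainTheorem16:
  fixes P :: "'a::euclidean_space set" and \<mu> \<sigma> :: "'a measure"
  assumes "system2 P \<mu> \<sigma>"
  shows "(\<forall>q\<in>E1 P \<mu>. (\<forall>q'\<in>E1 P \<mu>. NA_ratio P \<mu> \<sigma> q \<le> NA_ratio P \<mu> \<sigma> q') \<longrightarrow>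
            (\<exists>B. \<forall>x\<in>P. \<bar>q x\<bar> \<le> ereal B) \<and> continuous_on P q)
       \<and> (\<forall>u\<in>M1 P \<mu>. (\<forall>u'\<in>M1 P \<mu>. U_fun P \<mu> \<sigma> u \<le> U_fun P \<mu> \<sigma> u') \<longrightarrow>
            (\<exists>B. \<forall>x\<in>P. u x \<le> ennreal B) \<and> continuous_on P u)"
proof (intro conjI ballI impI)
  note P = system2D[OF assms]
  have bounded: "\<exists>B. \<forall>x\<in>P. \<bar>f x\<bar> \<le> B" if "c-lipschitz_on P f" for c and f :: "'a \<Rightarrow> real"
    using compact_continuous_image[OF lipschitz_on_continuous_on[OF that] P(2), THEN compact_imp_bounded]
    unfolding bounded_iff by auto
  {
    fix q assume q: "q \<in> E1 P \<mu>" "\<forall>q'\<in>E1 P \<mu>. NA_ratio P \<mu> \<sigma> q \<le> NA_ratio P \<mu> \<sigma> q'"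
    obtain c f where f: "c-lipschitz_on P f" "\<And>x. x \<in> P \<Longrightarrow> q x = ereal (f x)"
      by (rule lipschitz_minimizer[OF assms q(1) q(2)[rule_format]]) blast+
    show "\<exists>B. \<forall>x\<in>P. \<bar>q x\<bar> \<le> ereal B"
      using bounded[OF f(1)] f(2) by simp
    have "continuous_on P (\<lambda>x. ereal (f x))"
      by (intro continuous_on_ereal lipschitz_on_continuous_on[OF f(1)])
    then show "continuous_on P q" using f(2) by (simp cong: continuous_on_cong)
  next
    fix u assume u: "u \<in> M1 P \<mu>" "\<forall>u'\<in>M1 P \<mu>. U_fun P \<mu> \<sigma> u \<le> U_fun P \<mu> \<sigma> u'"
    \<comment> \<open>The logarithm of \<open>u\<close> minimises the ratio, so it is Lipschitz by
      the first half, and boundedness and continuity pass to its exponential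
      \<open>u\<close>.\<close>
    note q = eln_minimizer[OF assms u(1) u(2)[rule_format]]
    obtain c f where f: "c-lipschitz_on P f" "\<And>x. x \<in> P \<Longrightarrow> eln (u x) = ereal (f x)"
      by (rule lipschitz_minimizer[OF assms q]) blast+
    have u_eq: "u x = ennreal (exp (f x))" if "x \<in> P" for x
      using f(2)[OF that] eexp_eln[of "u x"] by (simp add: eexp_def)
    obtain B where "\<And>x. x \<in> P \<Longrightarrow> \<bar>f x\<bar> \<le> B" using bounded[OF f(1)] by blast
    then have "u x \<le> ennreal (exp B)" if "x \<in> P" for x
      using u_eq[OF that] that by (auto intro!: ennreal_leI simp: abs_le_iff)
    then show "\<exists>B. \<forall>x\<in>P. u x \<le> ennreal B" by blast
    have "continuous_on P (\<lambda>x. ennreal (exp (f x)))"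
      by (intro continuous_on_ennreal continuous_on_exp lipschitz_on_continuous_on[OF f(1)])
    then show "continuous_on P u" using u_eq by (simp cong: continuous_on_cong)
  }
qed

end
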